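(* Let $n\ge1$ be an integer, $k\ge\frac{n-1}{2n}$, $a,b>0$ and $1\le p,q\le+\infty$ with $\min(p,q)<+\infty$. Let $f$ be a measurable function on $\mathbb{R}$ such that $$\big\|e^{na|x|^{2/n}}f\big\|_{L^p_{k,n}}<+\infty\quad\text{and}\quad \big\|e^{nb|x|^{2/n}}\mathcal{F}_{k,n}f\big\|_{L^q_{k,n}}<+\infty.$$ Then: 1. If $ab\ge\frac14$, then $f=0$ almost everywhere. 2. If $ab<\frac14$, there exist infinitely many linearly independent functions satisfying both conditions.
   Context: Notation: $\alpha=kn-\frac n2$; $j_\beta(z)=\Gamma(\beta+1)\sum_{m\ge0}\frac{(-1)^m}{m!\,\Gamma(\beta+m+1)}(z/2)^{2m}$ is the normalized Bessel function; $d\mu_{k,n}(x)=\frac{1}{2\Gamma(kn-\frac n2+1)}(\frac n2)^{kn-\frac n2}|x|^{2k+\frac2n-2}dx$, $L^p_{k,n}=L^p(\mathbb{R},d\mu_{k,n})$ with the usual norm (essential sup for $p=\infty$). The $(k,\frac2n)$-generalized Fourier transform is $\mathcal{F}_{k,n}f(\lambda)=\int_{\mathbb{R}}f(x)B_{k,n}(x,\lambda)\,d\mu_{k,n}(x)$ with kernel $B_{k,n}(x,\lambda)=j_\alpha(n|\lambda x|^{1/n})+(-i)^n(\frac n2)^n\frac{\Gamma(\alpha+1)}{\Gamma(\alpha+n+1)}\lambda x\,j_{\alpha+n}(n|\lambda x|^{1/n})$. *)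

theory Defs
  imports "HOL-Analysis.Analysis"
begin

definition bessel_j :: "real \<Rightarrow> real \<Rightarrow> real" where
  "bessel_j \<beta> z = Gamma (\<beta> + 1) *
     (\<Sum>m. (-1) ^ m / (fact m * Gamma (\<beta> + real m + 1)) * (z / 2) ^ (2 * m))"

definition alpha_kn :: "real \<Rightarrow> nat \<Rightarrow> real" where
  "alpha_kn k n = k * real n - real n / 2"

definition mu_kn :: "real \<Rightarrow> nat \<Rightarrow> real measure" where
  "mu_kn k n = density lborel (\<lambda>x. ennreal
      (1 / (2 * Gamma (alpha_kn k n + 1)) * (real n / 2) powr (alpha_kn k n)
       * \<bar>x\<bar> powr (2 * k + 2 / real n - 2)))"

definition B_kn :: "real \<Rightarrow> nat \<Rightarrow> real \<Rightarrow> real \<Rightarrow> complex" where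
  "B_kn k n x l =
     complex_of_real (bessel_j (alpha_kn k n) (real n * \<bar>l * x\<bar> powr (1 / real n)))
     + (- \<i>) ^ n * complex_of_real ((real n / 2) ^ n * Gamma (alpha_kn k n + 1)
         / Gamma (alpha_kn k n + real n + 1) * l * x
         * bessel_j (alpha_kn k n + real n) (real n * \<bar>l * x\<bar> powr (1 / real n)))"

definition F_kn :: "real \<Rightarrow> nat \<Rightarrow> (real \<Rightarrow> complex) \<Rightarrow> real \<Rightarrow> complex" where
  "F_kn k n f l = (LINT x|mu_kn k n. f x * B_kn k n x l)"

definition Lp_finite :: "'a measure \<Rightarrow> ereal \<Rightarrow> ('a \<Rightarrow> complex) \<Rightarrow> bool" where
  "Lp_finite M p g =
     (if p = \<infinity> then (\<exists>C. AE x in M. norm (g x) \<le> C)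
      else (\<integral>\<^sup>+ x. ennreal (norm (g x) powr real_of_ereal p) \<partial>M) < \<infinity>)"

end

theory Submission
  imports Defs "HOL-Complex_Analysis.Complex_Analysis" "HOL-Probability.Probability"
    "HOL-Real_Asymp.Real_Asymp" "HOL-Computational_Algebra.Fundamental_Theorem_Algebra"
begin

text \<open>Put \<open>u x = \<bar>x\<bar> powr (2 / n)\<close>. The measure pushes forward under \<open>u\<close> to \<open>K * y powr \<alpha>\<close> on the
  half line, and the kernel is a power series in \<open>u x * u l\<close> plus \<open>x * l\<close> times another one. Hence the
  transform of a function with Gaussian decay \<open>exp (- c * u x)\<close> is \<open>G (u l) + const * l * H (u l)\<close>,
  where the Taylor coefficients of \<open>G\<close> and \<open>H\<close> are multiples of the moments of \<open>f\<close> and \<open>x * f\<close>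
  in \<open>u\<close>. The moment bounds show that \<open>G\<close> and \<open>H\<close> are entire and grow at most like
  \<open>(1 + norm w) * exp (B * norm w)\<close> with \<open>B = n\<^sup>2 / (4 * c)\<close>.

  By reducing \<open>b\<close> we may assume \<open>a * b = 1/4\<close>, that is \<open>n * b = B\<close>. Then \<open>exp (B * w) * G w\<close> grows linearly
  on the negative axis and is controlled in mean on the positive axis, so the Phragmen-Lindelof principle
  makes it a polynomial, and the integrability condition makes it constant; the corresponding function
  for \<open>H\<close> vanishes. Therefore \<open>f\<close> has the moments of a multiple of the Gaussian, and
  functions with exponential decay in \<open>u\<close> are determined by their moments. As \<open>p\<close> or \<open>q\<close> is
  finite and the measure is infinite, the multiple is 0. For \<open>a * b < 1/4\<close> there is room for a
  continuum of Gaussians with different rates.\<close>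

subsection \<open>A Phragmen-Lindelof principle\<close>

text \<open>The rate \<open>B = n\<^sup>2 / (4 * c)\<close> comes from an exact cancellation: the
  Gaussian moment of order \<open>m\<close> contains
  \<open>pochhammer (\<alpha> + 1) m / c ^ m\<close>, the kernel coefficient has modulus
  \<open>(n\<^sup>2 / 4) ^ m / (fact m * pochhammer (\<alpha> + 1) m)\<close>, and the product is
  \<open>B ^ m / fact m\<close>. With \<open>c = n * a\<close>, the equation
  \<open>n * b = B\<close> reads \<open>a * b = 1/4\<close>. The integrability hypotheses replace a
  bounded function by the sum of a bounded and an integrable one. The moments may then exceed the
  Gaussian ones by a factor linear in \<open>m\<close>; this is the factor \<open>1 + norm w\<close>
  in the growth, and the reason why polynomials appear before constants. G and H are separated by
  combining the values of the transform at \<open>l\<close> and \<open>- l\<close>. The factor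
  \<open>l\<close> in front of H is what excludes even a nonzero constant there. No inversion
  formula enters; injectivity rests on moments alone.\<close>

lemma phragmen_lindelof_half_strip:
  fixes G :: "complex \<Rightarrow> complex"
  assumes th: "0 < \<theta>" "\<theta> < pi" and M: "M > 0"
    and holG: "G holomorphic_on T" and T: "open T" "\<And>z. 0 \<le> Im z \<Longrightarrow> Im z \<le> \<theta> \<Longrightarrow> z \<in> T"
    and bottom: "\<And>z. Im z = 0 \<Longrightarrow> 0 \<le> Re z \<Longrightarrow> norm (G z) \<le> M"
    and top: "\<And>z. Im z = \<theta> \<Longrightarrow> 0 \<le> Re z \<Longrightarrow> norm (G z) \<le> M"
    and left: "\<And>z. Re z = 0 \<Longrightarrow> 0 \<le> Im z \<Longrightarrow> Im z \<le> \<theta> \<Longrightarrow> norm (G z) \<le> M"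
    and growth: "\<And>z. 0 \<le> Re z \<Longrightarrow> 0 \<le> Im z \<Longrightarrow> Im z \<le> \<theta> \<Longrightarrow> norm (G z) \<le> D * exp (A * exp (Re z))"
    and z: "0 \<le> Re z" "0 \<le> Im z" "Im z \<le> \<theta>"
  shows "norm (G z) \<le> M"
proof -
  \<comment> \<open>Halfway between 1 and \<open>pi / \<theta>\<close>: \<open>\<rho> > 1\<close>
    makes \<open>exp (\<rho> * Re z)\<close> beat the growth \<open>exp (Re z)\<close>, and
    \<open>\<rho> * \<theta> < pi\<close> keeps the cosine in \<open>Re_q\<close> positive on the
    strip.\<close>
  define \<rho> where "\<rho> = (1 + pi / \<theta>) / 2"
  have \<rho>: "\<rho> > 1" "\<rho> * \<theta> < pi" using th by (auto simp: \<rho>_def field_simps)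
  define \<kappa> where "\<kappa> = cos (\<rho> * \<theta> / 2)"
  have \<rho>th: "0 < \<rho> * \<theta>" using \<rho> th by simp
  have \<kappa>: "\<kappa> > 0" unfolding \<kappa>_def using \<rho> \<rho>th by (intro cos_gt_zero_pi) auto
  define q where "q = (\<lambda>z. exp (of_real \<rho> * (z - \<i> * of_real \<theta> / 2)))"
  have Re_q: "Re (q z) = exp (\<rho> * Re z) * cos (\<rho> * (Im z - \<theta> / 2))" for z
    by (simp add: q_def Re_exp)
  have Re_q_ge: "Re (q z) \<ge> \<kappa> * exp (\<rho> * Re z)" if "0 \<le> Im z" "Im z \<le> \<theta>" for z
  proof -
    have "\<bar>Im z - \<theta> / 2\<bar> \<le> \<theta> / 2" using that by linarith
    then have "\<bar>\<rho> * (Im z - \<theta> / 2)\<bar> \<le> \<rho> * \<theta> / 2"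
      using that \<rho> mult_left_mono[of "\<bar>Im z - \<theta>/2\<bar>" "\<theta>/2" \<rho>] by (auto simp: abs_mult abs_le_iff)
    then have "cos (\<rho> * \<theta> / 2) \<le> cos \<bar>\<rho> * (Im z - \<theta> / 2)\<bar>"
      using \<rho> th by (intro cos_monotone_0_pi_le) auto
    then show ?thesis by (simp add: Re_q \<kappa>_def mult.commute)
  qed
  \<comment> \<open>Damping by \<open>exp (- \<eta> * q z)\<close> makes \<open>G\<close> small on a
    far vertical side, so the maximum modulus principle on a rectangle applies; afterwards \<eta>
    tends to 0 at fixed \<open>z\<close>.\<close>
  have main: "norm (G z) * exp (- \<eta> * Re (q z)) \<le> M" if \<eta>: "\<eta> > 0" for \<eta>
  proof -
    define H where "H = (\<lambda>z. G z * exp (- of_real \<eta> * q z))"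
    have normH: "norm (H z) = norm (G z) * exp (- \<eta> * Re (q z))" for z
      by (simp add: H_def norm_mult)
    have H_le: "norm (H z) \<le> norm (G z) * exp (- \<eta> * \<kappa> * exp (\<rho> * Re z))"
      if "0 \<le> Im z" "Im z \<le> \<theta>" for z
      unfolding normH using Re_q_ge[OF that] \<eta> by (intro mult_left_mono) auto
    have H_le': "norm (H z) \<le> norm (G z)" if "0 \<le> Im z" "Im z \<le> \<theta>" for z
    proof -
      have "exp (- \<eta> * \<kappa> * exp (\<rho> * Re z)) \<le> 1" using \<eta> \<kappa> by simp
      then show ?thesis using H_le[OF that] mult_left_le[of _ "norm (G z)"] by fastforce
    qed
    have lim: "((\<lambda>X. D * exp (A * exp X) * exp (- \<eta> * \<kappa> * exp (\<rho> * X))) \<longlongrightarrow> 0) at_top"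
    proof -
      define e where "e = \<rho> - 1"
      have e: "e > 0" using \<rho> by (simp add: e_def)
      have 1: "A * exp X + - \<eta> * \<kappa> * exp (\<rho> * X) = exp X * (A - \<eta> * \<kappa> * exp (e * X))" for X
      proof -
        have "exp (\<rho> * X) = exp X * exp (e * X)"
          by (simp add: e_def algebra_simps flip: exp_add)
        then show ?thesis by (simp add: algebra_simps)
      qed
      have "\<eta> * \<kappa> > 0" using \<eta> \<kappa> by simp
      then have "filterlim (\<lambda>X. exp X * (A - \<eta> * \<kappa> * exp (e * X))) at_bot at_top"
        using e by real_asymp
      then have "((\<lambda>X. D * exp (exp X * (A - \<eta> * \<kappa> * exp (e * X)))) \<longlongrightarrow> D * 0) at_top"
        by (intro tendsto_mult tendsto_const filterlim_compose[OF exp_at_bot])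
      then show ?thesis unfolding 1[symmetric] exp_add by (simp add: mult.assoc)
    qed
    have "eventually (\<lambda>X. D * exp (A * exp X) * exp (- \<eta> * \<kappa> * exp (\<rho> * X)) < M) at_top"
      using order_tendstoD(2)[OF lim M] .
    then have "eventually (\<lambda>X. D * exp (A * exp X) * exp (- \<eta> * \<kappa> * exp (\<rho> * X)) < M \<and> X \<ge> Re z \<and> X > 0) at_top"
      using eventually_ge_at_top[of "Re z"] eventually_gt_at_top[of 0] by eventually_elim auto
    then obtain X where X: "D * exp (A * exp X) * exp (- \<eta> * \<kappa> * exp (\<rho> * X)) < M" "X \<ge> Re z" "X > 0"
      by (auto simp: eventually_at_top_linorder)
    define S where "S = {z. 0 \<le> Re z \<and> Re z \<le> X \<and> 0 \<le> Im z \<and> Im z \<le> \<theta>}"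
    have S_cbox: "S = cbox (Complex 0 0) (Complex X \<theta>)"
      by (auto simp: S_def in_cbox_complex_iff)
    have "norm (H z) \<le> M"
    proof (rule maximum_modulus_frontier[where f = H and S = S])
      have holH: "H holomorphic_on T"
        unfolding H_def q_def by (intro holomorphic_intros holG)
      have ST: "S \<subseteq> T" using T by (auto simp: S_def)
      show "H holomorphic_on interior S"
        using ST interior_subset by (intro holomorphic_on_subset[OF holH]) blast
      have "closed S" unfolding S_cbox by (rule closed_cbox)
      then show "continuous_on (closure S) H"
        using ST holomorphic_on_imp_continuous_on[OF holH] by (auto intro: continuous_on_subset)
      show "bounded S" unfolding S_cbox by (rule bounded_cbox)
      show "z \<in> S" using z X by (simp add: S_def)
      fix w assume "w \<in> frontier S"
      then have w: "w \<in> S" "w \<notin> box (Complex 0 0) (Complex X \<theta>)"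
        by (auto simp: S_cbox frontier_cbox)
      have w': "0 \<le> Im w" "Im w \<le> \<theta>" "0 \<le> Re w" using w by (auto simp: S_def)
      from w consider "Im w = 0" | "Im w = \<theta>" | "Re w = 0" | "Re w = X"
        by (force simp: S_def in_box_complex_iff)
      then show "norm (H w) \<le> M"
      proof cases
        case 1 then show ?thesis using H_le'[of w] bottom[of w] w' by linarith
      next
        case 2 then show ?thesis using H_le'[of w] top[of w] w' by linarith
      next
        case 3 then show ?thesis using H_le'[of w] left[of w] w' by linarith
      next
        case 4
        have "norm (H w) \<le> norm (G w) * exp (- \<eta> * \<kappa> * exp (\<rho> * X))"
          using H_le[of w] w' 4 by simp
        also have "\<dots> \<le> D * exp (A * exp X) * exp (- \<eta> * \<kappa> * exp (\<rho> * X))"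
          using growth[of w] w' 4 by (intro mult_right_mono) auto
        finally show ?thesis using X by linarith
      qed
    qed
    then show ?thesis by (simp add: normH)
  qed
  have "((\<lambda>\<eta>. norm (G z) * exp (- \<eta> * Re (q z))) \<longlongrightarrow> norm (G z) * exp (- 0 * Re (q z))) (at_right 0)"
    by (intro tendsto_intros)
  then have "norm (G z) * exp (- 0 * Re (q z)) \<le> M"
  proof (rule tendsto_upperbound)
    show "eventually (\<lambda>\<eta>. norm (G z) * exp (- \<eta> * Re (q z)) \<le> M) (at_right 0)"
      by (rule eventually_mono[OF eventually_at_right_less]) (rule main)
  qed simp
  then show ?thesis by simp
qed

text \<open>Order 1 is critical for a half plane. Here the growth rate near the negative axis is quadratic
  in the angle to that axis, so on a slightly smaller sector it is absorbed by a factor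
  \<open>exp (\<i> * \<delta> * w)\<close>, where \<open>\<delta>\<close> tends to 0 as the sector fills the half plane.
  The substitution \<open>w = exp z\<close> turns the sector into a half strip.\<close>

lemma phragmen_lindelof_upper_half_plane:
  fixes h :: "complex \<Rightarrow> complex"
  assumes B: "B \<ge> 0" and C: "C > 0"
    and hol: "h holomorphic_on U" and U: "open U" "\<And>w. Im w \<ge> 0 \<Longrightarrow> w \<in> U"
    and growth: "\<And>w. Im w \<ge> 0 \<Longrightarrow> norm (h w) \<le> C * exp (B * (norm w + Re w))"
    and axis: "\<And>x. x \<ge> 0 \<Longrightarrow> norm (h (of_real x)) \<le> C"
    and w: "Im w \<ge> 0"
  shows "norm (h w) \<le> C * exp (2 * B)"
\<comment> \<open>In the unit disc \<open>norm w + Re w \<le> 2\<close>, whence the constant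
  \<open>exp (2 * B)\<close>. Outside it \<open>Ln w\<close> lies in a half strip whose left side
  maps to an arc of the unit circle, with the same bound.\<close>
proof (cases "norm w \<le> 1")
  case True
  have "norm (h w) \<le> C * exp (B * (norm w + Re w))" using growth w by simp
  also have "B * (norm w + Re w) \<le> 2 * B"
    using True complex_Re_le_cmod[of w] B mult_left_mono[of "norm w + Re w" 2 B] by (simp add: mult.commute)
  then have "C * exp (B * (norm w + Re w)) \<le> C * exp (2 * B)" using C by simp
  finally show ?thesis .
next
  case False
  then have w0: "w \<noteq> 0" by auto
  show ?thesis
  \<comment> \<open>The negative axis lies outside every sector of angle
    \<open>pi - \<epsilon>\<close>, but there \<open>norm w + Re w = 0\<close> and the growth bound
    alone suffices.\<close>
  proof (cases "Arg w = pi")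
    case True
    then have "Re w < 0 \<and> Im w = 0" by (simp add: Arg_eq_pi)
    then have "norm w + Re w = 0" by (simp add: cmod_def)
    then have "norm (h w) \<le> C * exp 0" using growth[OF w] by simp
    also have "\<dots> \<le> C * exp (2 * B)" using B C by simp
    finally show ?thesis .
  next
    case Argw: False
    define \<zeta> where "\<zeta> = Ln w"
    have exp\<zeta>: "exp \<zeta> = w" using w0 by (simp add: \<zeta>_def)
    have Im\<zeta>: "0 \<le> Im \<zeta>" "Im \<zeta> < pi"
      using w Argw w0 Im_Ln_le_pi[OF w0] Im_Ln_pos_le[OF w0]
      by (auto simp: \<zeta>_def Arg_def less_le)
    have Re\<zeta>: "Re \<zeta> \<ge> 0" using False w0 by (simp add: \<zeta>_def)
    have *: "norm (h w) * exp (- B * tan (\<epsilon> / 2) * Im w) \<le> C * exp (2 * B)"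
      if \<epsilon>: "0 < \<epsilon>" "\<epsilon> < pi - Im \<zeta>" for \<epsilon>
    proof -
      \<comment> \<open>Solves \<open>\<delta> * sin \<epsilon> = B * (1 - cos \<epsilon>)\<close>:
        on the ray at angle \<open>pi - \<epsilon>\<close> the damping cancels the growth
        exactly.\<close>
      define \<delta> where "\<delta> = B * tan (\<epsilon> / 2)"
      have tan0: "tan (\<epsilon>/2) \<ge> 0" using \<epsilon> Im\<zeta> by (intro tan_pos_pi2_le) auto
      then have \<delta>0: "\<delta> \<ge> 0" using B by (simp add: \<delta>_def)
      have coshalf: "cos (\<epsilon>/2) > 0" using \<epsilon> Im\<zeta> by (intro cos_gt_zero_pi) auto
      have \<delta>: "\<delta> * sin \<epsilon> = B * (1 - cos \<epsilon>)"
      proof -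
        have "sin \<epsilon> = 2 * sin (\<epsilon>/2) * cos (\<epsilon>/2)" using sin_double[of "\<epsilon>/2"] by simp
        moreover have "cos \<epsilon> = 1 - 2 * (sin (\<epsilon>/2))\<^sup>2" using cos_double_sin[of "\<epsilon>/2"] by simp
        ultimately show ?thesis using coshalf by (simp add: \<delta>_def tan_def power2_eq_square)
      qed
      define G where "G = (\<lambda>z. h (exp z) * exp (\<i> * of_real \<delta> * exp z))"
      have Imexp: "Im (exp z) \<ge> 0" if "0 \<le> Im z" "Im z \<le> pi - \<epsilon>" for z
        using that \<epsilon> by (simp add: Im_exp sin_ge_zero)
      have normG: "norm (G z) = norm (h (exp z)) * exp (- \<delta> * Im (exp z))" for z
        by (simp add: G_def norm_mult)
      have G_le: "norm (G z) \<le> norm (h (exp z))" if "0 \<le> Im z" "Im z \<le> pi - \<epsilon>" for z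
      proof -
        have "exp (- \<delta> * Im (exp z)) \<le> 1" using Imexp[OF that] \<delta>0 by simp
        then show ?thesis unfolding normG by (simp add: mult_left_le)
      qed
      have h_le: "norm (h (exp z)) \<le> C * exp (2 * B * exp (Re z))" if "0 \<le> Im z" "Im z \<le> pi - \<epsilon>" for z
      proof -
        have "norm (h (exp z)) \<le> C * exp (B * (norm (exp z) + Re (exp z)))"
          using growth[OF Imexp[OF that]] .
        also have "B * (norm (exp z) + Re (exp z)) \<le> B * (2 * exp (Re z))"
          using B complex_Re_le_cmod[of "exp z"] by (intro mult_left_mono) auto
        then have "C * exp (B * (norm (exp z) + Re (exp z))) \<le> C * exp (2 * B * exp (Re z))"
          using C by (simp add: mult_ac)
        finally show ?thesis .
      qed
      have C_le: "C \<le> C * exp (2 * B)" using B C by simp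
      have "norm (G \<zeta>) \<le> C * exp (2 * B)"
      proof (rule phragmen_lindelof_half_strip[where G = G and \<theta> = "pi - \<epsilon>" and T = "exp -` U" and D = C and A = "2 * B"])
        show "0 < pi - \<epsilon>" "pi - \<epsilon> < pi" "0 \<le> Re \<zeta>" "0 \<le> Im \<zeta>" "Im \<zeta> \<le> pi - \<epsilon>"
          using \<epsilon> Im\<zeta> Re\<zeta> by auto
        show "C * exp (2 * B) > 0" using C by simp
        have "h \<circ> exp holomorphic_on exp -` U"
          by (rule holomorphic_on_compose_gen[OF _ hol]) (auto intro: holomorphic_intros)
        then show "G holomorphic_on exp -` U"
          unfolding G_def comp_def by (intro holomorphic_intros)
        show "open (exp -` U :: complex set)" using U by (intro open_vimage continuous_intros)
        show "z \<in> exp -` U" if "0 \<le> Im z" "Im z \<le> pi - \<epsilon>" for z using U Imexp[OF that] by simp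
        show "norm (G z) \<le> C * exp (2 * B)" if "Im z = 0" "0 \<le> Re z" for z
        proof -
          have "exp z = of_real (exp (Re z))" using that by (simp add: complex_eq_iff Re_exp Im_exp)
          then have "norm (h (exp z)) \<le> C" using axis[of "exp (Re z)"] by simp
          then show ?thesis using G_le[of z] that \<epsilon> Im\<zeta> C_le by simp
        qed
        show "norm (G z) \<le> C * exp (2 * B)" if "Im z = pi - \<epsilon>" "0 \<le> Re z" for z
        proof -
          have i: "Im (exp z) = exp (Re z) * sin \<epsilon>" using that by (simp add: Im_exp)
          have r: "norm (exp z) + Re (exp z) = exp (Re z) * (1 - cos \<epsilon>)"
            unfolding Re_exp norm_exp_eq_Re that(1) cos_pi_minus by (simp add: algebra_simps)
          have "norm (G z) \<le> C * exp (B * (norm (exp z) + Re (exp z))) * exp (- \<delta> * Im (exp z))"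
            unfolding normG using growth[of "exp z"] Imexp[of z] that \<epsilon> Im\<zeta> by (intro mult_right_mono) auto
          also have "\<dots> = C * exp (exp (Re z) * (B * (1 - cos \<epsilon>) - \<delta> * sin \<epsilon>))"
            unfolding i r mult.assoc exp_add[symmetric] by (simp add: algebra_simps)
          also have "\<dots> = C" by (simp add: \<delta>)
          finally show ?thesis using C_le by simp
        qed
        show "norm (G z) \<le> C * exp (2 * B)" if "Re z = 0" "0 \<le> Im z" "Im z \<le> pi - \<epsilon>" for z
          using G_le[OF that(2,3)] h_le[OF that(2,3)] that by simp
        show "norm (G z) \<le> C * exp (2 * B * exp (Re z))" if "0 \<le> Im z" "Im z \<le> pi - \<epsilon>" for z
          using G_le[OF that] h_le[OF that] by simp
      qed
      then show ?thesis by (simp add: normG exp\<zeta> \<delta>_def)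
    qed
    have "((\<lambda>\<epsilon>. norm (h w) * exp (- B * tan (\<epsilon> / 2) * Im w)) \<longlongrightarrow>
        norm (h w) * exp (- B * tan (0 / 2) * Im w)) (at_right 0)"
      by (intro tendsto_intros) auto
    moreover have "eventually (\<lambda>\<epsilon>. norm (h w) * exp (- B * tan (\<epsilon> / 2) * Im w) \<le> C * exp (2 * B)) (at_right 0)"
      by (rule eventually_mono[OF eventually_at_right_real[of 0 "pi - Im \<zeta>"]])
         (use Im\<zeta> in simp, rule *, auto)
    ultimately have "norm (h w) * exp (- B * tan (0 / 2) * Im w) \<le> C * exp (2 * B)"
      by (rule tendsto_upperbound) auto
    then show ?thesis by simp
  qed
qed

text \<open>Division by \<open>(w + \<i>) ^ N\<close> reduces to the bounded case: the pole at
  \<open>- \<i>\<close> is outside the closed upper half plane, and on that half plane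
  \<open>norm (w + \<i>)\<close> is comparable to \<open>1 + norm w\<close>.\<close>

lemma poly_growth_upper_half_plane:
  fixes E :: "complex \<Rightarrow> complex"
  assumes B: "B \<ge> 0" and C: "C > 0" and hol: "E holomorphic_on UNIV"
    and growth: "\<And>w. norm (E w) \<le> C * (1 + norm w) ^ N * exp (B * (norm w + Re w))"
    and axis: "\<And>x. x \<ge> 0 \<Longrightarrow> norm (E (of_real x)) \<le> C * (1 + x) ^ N"
    and w: "Im w \<ge> 0"
  shows "norm (E w) \<le> C * 2 ^ N * exp (2 * B) * (1 + norm w) ^ N"
proof -
  define h where "h = (\<lambda>w. E w / (w + \<i>) ^ N)"
  have nz: "w + \<i> \<noteq> 0" if "Im w > -1" for w
    using that by (auto simp: complex_eq_iff)
  have low: "1 + norm w \<le> 2 * norm (w + \<i>)" if "Im w \<ge> 0" for w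
  proof -
    have "norm w \<le> norm (w + \<i>)" using that unfolding cmod_def
      by (intro real_sqrt_le_mono) (auto intro!: power_mono)
    moreover have "1 \<le> norm (w + \<i>)" using abs_Im_le_cmod[of "w + \<i>"] that by simp
    ultimately show ?thesis by simp
  qed
  have h_le: "norm (h w) \<le> C * 2 ^ N * X" if "Im w \<ge> 0" "norm (E w) \<le> C * (1 + norm w) ^ N * X" "X \<ge> 0" for w X
  proof -
    have n0: "norm (w + \<i>) > 0" using nz[of w] that by simp
    have "norm (E w) \<le> C * (1 + norm w) ^ N * X" by fact
    also have "\<dots> \<le> C * (2 * norm (w + \<i>)) ^ N * X"
      using C that low[of w] by (intro mult_left_mono mult_right_mono power_mono) auto
    finally show ?thesis using n0
      by (simp add: h_def norm_divide norm_power field_simps power_mult_distrib)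
  qed
  have "norm (h w) \<le> C * 2 ^ N * exp (2 * B)"
  proof (rule phragmen_lindelof_upper_half_plane[OF B, where h = h and U = "{w. Im w > -1}"])
    show "C * 2 ^ N > 0" using C by simp
    show "h holomorphic_on {w. Im w > -1}" unfolding h_def
      using nz by (intro holomorphic_intros holomorphic_on_subset[OF hol]) auto
    show "open {w. Im w > -1}" by (rule open_halfspace_Im_gt)
    show "norm (h w) \<le> C * 2 ^ N * exp (B * (norm w + Re w))" if "Im w \<ge> 0" for w
      using h_le[OF that growth] by simp
    show "norm (h (of_real x)) \<le> C * 2 ^ N" if "x \<ge> 0" for x
      using h_le[of "of_real x" 1] axis[OF that] that by simp
  qed (use w in auto)
  then have "norm (E w) \<le> C * 2 ^ N * exp (2 * B) * norm (w + \<i>) ^ N"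
    using nz[of w] w by (simp add: h_def norm_divide norm_power field_simps)
  also have "\<dots> \<le> C * 2 ^ N * exp (2 * B) * (1 + norm w) ^ N"
    using C norm_triangle_ineq[of w \<i>] by (intro mult_left_mono power_mono) auto
  finally show ?thesis .
qed

text \<open>Both bounds are invariant under conjugation, so \<open>cnj (E (cnj w))\<close> yields
  the lower half plane; Liouville's theorem for polynomial growth then applies.\<close>

lemma entire_polynomial_growth:
  fixes E :: "complex \<Rightarrow> complex"
  assumes B: "B \<ge> 0" and C: "C > 0" and hol: "E holomorphic_on UNIV"
    and growth: "\<And>w. norm (E w) \<le> C * (1 + norm w) ^ N * exp (B * (norm w + Re w))"
    and axis: "\<And>x. x \<ge> 0 \<Longrightarrow> norm (E (of_real x)) \<le> C * (1 + x) ^ N"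
  shows "\<exists>P. \<forall>w. E w = poly P w"
proof -
  have le: "norm (E w) \<le> C * 2 ^ N * exp (2 * B) * (1 + norm w) ^ N" for w
  proof (cases "Im w \<ge> 0")
    case True
    then show ?thesis using poly_growth_upper_half_plane[OF assms] by simp
  next
    case False
    have "cnj \<circ> E \<circ> cnj holomorphic_on UNIV"
      by (intro holomorphic_on_compose_cnj_cnj holomorphic_on_subset[OF hol]) auto
    then have hol': "(\<lambda>w. cnj (E (cnj w))) holomorphic_on UNIV" by (simp add: comp_def)
    have "norm (cnj (E (cnj (cnj w)))) \<le> C * 2 ^ N * exp (2 * B) * (1 + norm (cnj w)) ^ N"
      using False growth[of "cnj _"] axis
      by (intro poly_growth_upper_half_plane[OF B C hol']) auto
    then show ?thesis by simp
  qed
  define D where "D = C * 2 ^ N * exp (2 * B) * 2 ^ N"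
  have le2: "norm (E w) \<le> D * norm w ^ N" if "1 \<le> norm w" for w
  proof -
    have "(1 + norm w) ^ N \<le> (2 * norm w) ^ N" using that by (intro power_mono) auto
    then have "C * 2 ^ N * exp (2 * B) * (1 + norm w) ^ N \<le> C * 2 ^ N * exp (2 * B) * (2 * norm w) ^ N"
      using C by (intro mult_left_mono) auto
    then show ?thesis using le[of w] by (simp add: D_def power_mult_distrib mult_ac)
  qed
  have "E w = (\<Sum>k\<le>N. (deriv^^k) E 0 / fact k * w ^ k)" for w
    by (rule Liouville_polynomial[OF hol le2])
  then have "E w = poly (\<Sum>k\<le>N. monom ((deriv^^k) E 0 / fact k) k) w" for w
    by (simp add: poly_sum poly_monom)
  then show ?thesis by blast
qed

subsection \<open>Functions determined by their moments\<close>

lemma exp_sums: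
  fixes x :: "'a::{real_normed_field, banach}"
  shows "(\<lambda>j. x ^ j / fact j) sums exp x"
  using exp_converges[of x] by (simp add: scaleR_conv_of_real divide_inverse mult.commute)

lemma sum_power_fact_le_exp:
  fixes x :: real
  assumes "x \<ge> 0"
  shows "(\<Sum>j<N. x ^ j / fact j) \<le> exp x"
  using assms exp_sums[of x] sum_le_suminf[of "\<lambda>j. x ^ j / fact j" "{..<N}"]
  by (auto simp: sums_iff)

lemma power_le_fact_mult_exp:
  fixes x :: real
  assumes "x \<ge> 0"
  shows "x ^ m \<le> fact m * exp x"
proof -
  have "x ^ m / fact m \<le> (\<Sum>j<Suc m. x ^ j / fact j)"
    using assms by (simp add: sum_nonneg)
  also have "\<dots> \<le> exp x" using assms by (rule sum_power_fact_le_exp)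
  finally show ?thesis by (simp add: field_simps)
qed

text \<open>The power is paid for by the surplus \<open>e = c - d\<close> of the exponential,
  through \<open>y ^ m \<le> fact m / e ^ m * exp (e * y)\<close>.\<close>

lemma power_exp_integrable:
  fixes F u :: "'a \<Rightarrow> real"
  assumes [measurable]: "F \<in> borel_measurable M" "u \<in> borel_measurable M"
    and u: "\<And>x. u x \<ge> 0" and c: "d < c"
    and int: "integrable M (\<lambda>x. F x * exp (c * u x))"
  shows "integrable M (\<lambda>x. \<bar>F x\<bar> * u x ^ m * exp (d * u x))"
proof (rule Bochner_Integration.integrable_bound)
  let ?D = "fact m / (c - d) ^ m"
  show "integrable M (\<lambda>x. ?D * (F x * exp (c * u x)))" using int by simp
  have "\<bar>F x\<bar> * u x ^ m * exp (d * u x) \<le> ?D * (\<bar>F x\<bar> * exp (c * u x))" for x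
  proof -
    define e where "e = c - d"
    have e: "e > 0" using c by (simp add: e_def)
    have "u x ^ m \<le> fact m / e ^ m * exp (e * u x)"
      using power_le_fact_mult_exp[of "e * u x" m] u[of x] e
      by (simp add: power_mult_distrib field_simps)
    then have "u x ^ m \<le> ?D * exp ((c - d) * u x)" by (simp only: e_def)
    then have "u x ^ m * exp (d * u x) \<le> ?D * exp ((c - d) * u x) * exp (d * u x)"
      by (intro mult_right_mono) auto
    also have "\<dots> = ?D * exp (c * u x)" by (simp add: algebra_simps flip: exp_add)
    finally show ?thesis using mult_left_mono[of _ _ "\<bar>F x\<bar>"] by (fastforce simp: mult_ac)
  qed
  then show "AE x in M. norm (\<bar>F x\<bar> * u x ^ m * exp (d * u x)) \<le> norm (?D * (F x * exp (c * u x)))"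
    using u c by (auto simp: abs_mult)
qed measurable

text \<open>The set of frequencies at which the Fourier transform of \<open>F\<close> and all its derivatives
  vanish is invariant under shifts by less than the radius of convergence.\<close>

lemma zero_moments_imp_zero_char:
  fixes F u :: "'a \<Rightarrow> real"
  assumes [measurable]: "F \<in> borel_measurable M" "u \<in> borel_measurable M"
    and u: "\<And>x. u x \<ge> 0" and c: "c > 0"
    and int: "integrable M (\<lambda>x. F x * exp (c * u x))"
    and moments: "\<And>m. (LINT x|M. F x * u x ^ m) = 0"
  shows "(LINT x|M. complex_of_real (F x) * iexp (t * u x)) = 0"
proof -
  define Q where "Q = (\<lambda>t m. (LINT x|M. complex_of_real (F x * u x ^ m) * iexp (t * u x)) = 0)"
  \<comment> \<open>Expanding \<open>exp (\<i> * d * u x)\<close> turns the integral at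
    \<open>s + d\<close> into a series of the integrals in \<open>Q s (m + j)\<close>. The partial
    sums are dominated by \<open>\<bar>F x\<bar> * u x ^ m * exp (\<bar>d\<bar> * u x)\<close>,
    which is integrable because \<open>\<bar>d\<bar> < c\<close>.\<close>
  have step: "Q (s + d) m" if Q: "\<And>m. Q s m" and d: "\<bar>d\<bar> \<le> c / 2" for s d m
  proof -
    define S where "S = (\<lambda>N x. \<Sum>j<N. (\<i> * d) ^ j / fact j *
        (complex_of_real (F x * u x ^ (m + j)) * iexp (s * u x)))"
    have int': "integrable M (\<lambda>x. complex_of_real (F x * u x ^ m) * iexp (s * u x))" for m
      by (rule Bochner_Integration.integrable_bound[OF power_exp_integrable[OF _ _ u _ int, of 0 m]])
         (use c u in \<open>auto simp: norm_mult abs_mult norm_power\<close>)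
    have S_eq: "S N x = complex_of_real (F x * u x ^ m) * iexp (s * u x) * (\<Sum>j<N. (\<i> * d * u x) ^ j / fact j)" for N x
      by (simp add: S_def sum_distrib_left power_mult_distrib power_add field_simps)
    have "(\<lambda>N. LINT x|M. S N x) \<longlonglongrightarrow> (LINT x|M. complex_of_real (F x * u x ^ m) * iexp (s * u x) * exp (\<i> * d * u x))"
    proof (rule integral_dominated_convergence)
      show "integrable M (\<lambda>x. \<bar>F x\<bar> * u x ^ m * exp (\<bar>d\<bar> * u x))"
        using d c by (intro power_exp_integrable[OF _ _ u _ int]) auto
      show "AE x in M. (\<lambda>N. S N x) \<longlonglongrightarrow> complex_of_real (F x * u x ^ m) * iexp (s * u x) * exp (\<i> * d * u x)"
        unfolding S_eq using exp_sums[where 'a = complex] by (auto intro!: tendsto_mult tendsto_const simp: sums_def)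
      fix N
      show "AE x in M. norm (S N x) \<le> \<bar>F x\<bar> * u x ^ m * exp (\<bar>d\<bar> * u x)"
      proof (intro AE_I2)
        fix x
        have "norm (\<Sum>j<N. (\<i> * d * u x) ^ j / fact j) \<le> (\<Sum>j<N. norm ((\<i> * d * u x) ^ j / fact j))"
          by (rule norm_sum)
        also have "\<dots> = (\<Sum>j<N. (\<bar>d\<bar> * u x) ^ j / fact j)"
          using u[of x] by (simp add: norm_divide norm_power norm_mult)
        also have "\<dots> \<le> exp (\<bar>d\<bar> * u x)"
          using u[of x] by (intro sum_power_fact_le_exp) auto
        finally show "norm (S N x) \<le> \<bar>F x\<bar> * u x ^ m * exp (\<bar>d\<bar> * u x)"
          unfolding S_eq norm_mult norm_of_real using u[of x]
          by (auto simp: abs_mult intro!: mult_left_mono)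
      qed
    qed (auto simp: S_def)
    moreover have "(LINT x|M. S N x) = 0" for N
      unfolding S_def using Q int' by (subst Bochner_Integration.integral_sum) (auto simp: Q_def)
    ultimately have "(LINT x|M. complex_of_real (F x * u x ^ m) * iexp (s * u x) * exp (\<i> * d * u x)) = 0"
      by (simp add: LIMSEQ_const_iff)
    moreover have "iexp (s * u x) * exp (\<i> * d * u x) = iexp ((s + d) * u x)" for x
      by (simp add: algebra_simps flip: exp_add)
    ultimately show ?thesis by (simp add: Q_def mult.assoc)
  qed
  have "Q s m" if "\<bar>s\<bar> \<le> real N * (c / 2)" for N s m
    using that
  proof (induction N arbitrary: s m)
    case 0
    then show ?case using moments by (simp add: Q_def flip: of_real_mult of_real_power)
  next
    case (Suc N)
    \<comment> \<open>The clipping of \<open>s\<close> to one admissible shift; the rest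
      \<open>s - d\<close> is within \<open>N\<close> shifts of 0.\<close>
    define d where "d = max (- (c/2)) (min (c/2) s)"
    have "\<bar>s - d\<bar> \<le> real N * (c / 2)" "\<bar>d\<bar> \<le> c / 2"
      using Suc.prems c by (auto simp: d_def algebra_simps max_def min_def)
    then show ?case using step[of "s - d" d] Suc.IH by simp
  qed
  moreover obtain N :: nat where "\<bar>t\<bar> / (c/2) \<le> real N" using real_arch_simple by blast
  ultimately have "Q t 0" using c by (simp add: field_simps)
  then show ?thesis by (simp add: Q_def)
qed

text \<open>The positive and negative parts of \<open>F\<close>, pushed forward by \<open>u\<close>
  and normalised, are probability measures with equal characteristic functions, hence equal by
  Levy's uniqueness theorem. The moment of order 0 gives both parts the same mass; if it is 0, both
  vanish almost everywhere.\<close>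

lemma zero_moments_imp_zero_integral_vimage:
  fixes F u :: "'a \<Rightarrow> real"
  assumes [measurable]: "F \<in> borel_measurable M" "u \<in> borel_measurable M"
    and u: "\<And>x. u x \<ge> 0" and c: "c > 0"
    and int: "integrable M (\<lambda>x. F x * exp (c * u x))"
    and moments: "\<And>m. (LINT x|M. F x * u x ^ m) = 0"
    and A [measurable]: "A \<in> sets borel"
  shows "(LINT x|M. F x * indicator A (u x)) = 0"
proof -
  have intF: "integrable M F"
    using power_exp_integrable[OF _ _ u _ int, of 0 0] c by (simp add: integrable_abs_iff)
  define F' where "F' = (\<lambda>s x. max 0 (s * F x))"
  have [measurable]: "F' s \<in> borel_measurable M" for s unfolding F'_def by measurable
  have F'0: "F' s x \<ge> 0" for s x by (simp add: F'_def)
  have intF': "integrable M (F' s)" for s unfolding F'_def using intF by auto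
  have F'diff: "F' 1 x - F' (-1) x = F x" for x by (auto simp: F'_def)
  define m where "m = (LINT x|M. F' 1 x)"
  have m: "(LINT x|M. F' s x) = m" if "s \<in> {1, -1}" for s
  proof -
    have "(LINT x|M. F' 1 x) - (LINT x|M. F' (-1) x) = (LINT x|M. F x)"
      using intF' by (subst Bochner_Integration.integral_diff[symmetric]) (auto simp: F'diff)
    then show ?thesis using that moments[of 0] by (auto simp: m_def)
  qed
  show ?thesis
  proof (cases "m = 0")
    case True
    then have "AE x in M. F' s x = 0" if "s \<in> {1,-1}" for s
      using m[OF that] integral_nonneg_eq_0_iff_AE[OF intF'[of s]] F'0 by simp
    from this[of 1, simplified] this[of "-1", simplified] have "AE x in M. F x * indicator A (u x) = 0"
    proof eventually_elim
      case (elim x)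
      then show ?case using F'diff[of x] by simp
    qed
    then show ?thesis by (rule integral_eq_zero_AE)
  next
    case False
    have mpos: "m > 0" using False F'0 by (simp add: m_def less_le integral_nonneg_AE)
    define N where "N = (\<lambda>s. distr (density M (\<lambda>x. ennreal (F' s x / m))) borel u)"
    have N_int: "(LINT y|N s. g y) = (LINT x|M. (F' s x / m) *\<^sub>R g (u x))"
      if [measurable]: "g \<in> borel_measurable borel" for s and g :: "real \<Rightarrow> complex"
      unfolding N_def using F'0 mpos
      by (subst integral_distr, measurable, subst integral_density) auto
    have dist: "real_distribution (N s)" if "s \<in> {1, -1}" for s
    proof -
      have "emeasure (density M (\<lambda>x. ennreal (F' s x / m))) (space M) = (\<integral>\<^sup>+ x. ennreal (F' s x / m) \<partial>M)"
        by (subst emeasure_density) (auto intro!: nn_integral_cong)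
      also have "\<dots> = ennreal (LINT x|M. F' s x / m)"
        using intF' F'0 mpos by (intro nn_integral_eq_integral) auto
      also have "\<dots> = 1" using m[OF that] mpos by simp
      finally have "prob_space (density M (\<lambda>x. ennreal (F' s x / m)))"
        by (intro prob_spaceI) simp
      then have "prob_space (N s)" unfolding N_def by (rule prob_space.prob_space_distr) simp
      then show ?thesis by (simp add: real_distribution_def real_distribution_axioms_def N_def)
    qed
    have int2: "integrable M (\<lambda>x. (F' s x / m) *\<^sub>R g (u x))"
      if [measurable]: "g \<in> borel_measurable borel" and "\<And>y. norm (g y) \<le> 1" for s and g :: "real \<Rightarrow> complex"
      by (rule Bochner_Integration.integrable_bound[where f = "\<lambda>x. F' s x / m"])
         (use intF' F'0 mpos that(2) in \<open>auto simp: divide_right_mono mult_left_le\<close>)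
    have diff: "(LINT y|N 1. g y) - (LINT y|N (-1). g y) = (LINT x|M. complex_of_real (F x) * g (u x)) / m"
      if [measurable]: "g \<in> borel_measurable borel" and "\<And>y. norm (g y) \<le> 1" for g
    proof -
      have "(LINT y|N 1. g y) - (LINT y|N (-1). g y) =
          (LINT x|M. (F' 1 x / m) *\<^sub>R g (u x) - (F' (-1) x / m) *\<^sub>R g (u x))"
        using int2[OF that] by (simp add: N_int)
      also have "\<dots> = (LINT x|M. complex_of_real (F x) * g (u x) / m)"
        by (intro Bochner_Integration.integral_cong refl)
           (auto simp: scaleR_conv_of_real F'diff[symmetric] diff_divide_distrib algebra_simps)
      finally show ?thesis by simp
    qed
    have "char (N 1) = char (N (-1))"
    proof
      fix t
      show "char (N 1) t = char (N (-1)) t"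
        using diff[of "\<lambda>y. iexp (t * y)"] zero_moments_imp_zero_char[OF _ _ u c int moments, of t]
        by (simp add: char_def)
    qed
    then have "N 1 = N (-1)" using dist by (intro Levy_uniqueness) auto
    then have "(LINT x|M. complex_of_real (F x) * complex_of_real (indicator A (u x))) = 0"
      using diff[of "\<lambda>y. complex_of_real (indicator A y)"] mpos by (simp add: indicator_def)
    then have "(LINT x|M. complex_of_real (F x * indicator A (u x))) = 0"
      by (simp del: of_real_indicator)
    then show ?thesis by (simp del: of_real_mult)
  qed
qed

subsection \<open>The weighted measure\<close>

text \<open>The condition on \<open>k\<close> is equivalent to \<open>\<alpha> \<ge> -1/2\<close>,
  the form in which it is used.\<close>

locale kn_weight =
  fixes n :: nat and k :: real
  assumes n: "n \<ge> 1" and k: "k \<ge> (real n - 1) / (2 * real n)"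
begin

abbreviation \<alpha> :: real where "\<alpha> \<equiv> alpha_kn k n"
abbreviation \<mu> :: "real measure" where "\<mu> \<equiv> mu_kn k n"

definition u :: "real \<Rightarrow> real" where "u x = \<bar>x\<bar> powr (2 / real n)"

text \<open>The constant of the image density: two preimages of \<open>y\<close> under
  \<open>u\<close> and the factor \<open>n / 2\<close> from differentiating
  \<open>y powr (n / 2)\<close> multiply the constant of \<open>mu_kn\<close> by
  \<open>n\<close>.\<close>

definition K :: real where "K = real n / (2 * Gamma (\<alpha> + 1)) * (real n / 2) powr \<alpha>"

lemma alpha_ge: "\<alpha> \<ge> -1/2"
proof -
  have "k * real n \<ge> (real n - 1) / (2 * real n) * real n" using k by (intro mult_right_mono) auto
  also have "(real n - 1) / (2 * real n) * real n = (real n - 1) / 2" using n by simp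
  finally show ?thesis by (simp add: alpha_kn_def field_simps)
qed

lemma K_pos: "K > 0"
  using n alpha_ge by (auto simp: K_def intro!: mult_pos_pos divide_pos_pos Gamma_real_pos)

lemma u_nonneg [simp]: "u x \<ge> 0" by (simp add: u_def)

lemma u_minus [simp]: "u (- x) = u x" by (simp add: u_def)

lemma u_mult: "u (x * y) = u x * u y" by (simp add: u_def abs_mult powr_mult)

lemma abs_eq_u_powr: "\<bar>x\<bar> = u x powr (real n / 2)"
  using n by (simp add: u_def powr_powr)

lemma u_le_iff: "r \<ge> 0 \<Longrightarrow> u x \<le> r \<longleftrightarrow> \<bar>x\<bar> \<le> r powr (real n / 2)"
  using n powr_less_mono2[of "real n / 2" r "u x"] powr_mono2[of "real n / 2" "u x" r]
  by (subst abs_eq_u_powr) (auto simp: not_le[symmetric])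

lemma measurable_u [measurable]: "u \<in> borel_measurable borel"
  unfolding u_def by measurable

lemma sets_mu [simp, measurable_cong]: "sets \<mu> = sets borel" by (simp add: mu_kn_def)

lemma space_mu [simp]: "space \<mu> = UNIV" by (simp add: mu_kn_def)

lemma mu_eq: "\<mu> = density lborel (\<lambda>x. ennreal (K / n * \<bar>x\<bar> powr (2 * (\<alpha> + 1) / n - 1)))"
proof -
  have "2 * k + 2 / n - 2 = 2 * (\<alpha> + 1) / n - 1"
    using n by (simp add: alpha_kn_def field_simps)
  then show ?thesis using n by (simp add: mu_kn_def K_def)
qed

lemma distr_mu_uminus: "distr \<mu> borel uminus = \<mu>"
proof -
  let ?w = "\<lambda>x. ennreal (K / n * \<bar>x\<bar> powr (2 * (\<alpha> + 1) / n - 1))"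
  have "distr (density lborel (?w \<circ> uminus)) borel uminus = density (distr lborel borel uminus) ?w"
    by (subst density_distr) (auto simp: comp_def)
  then show ?thesis by (simp add: mu_eq comp_def lborel_distr_uminus)
qed

lemma integral_mu_reflect:
  fixes g :: "real \<Rightarrow> 'b::{banach, second_countable_topology}"
  assumes "g \<in> borel_measurable borel"
  shows "(LINT x|\<mu>. g (- x)) = (LINT x|\<mu>. g x)"
  using integral_distr[of uminus \<mu> borel g] assms by (simp add: distr_mu_uminus)

lemma integrable_mu_reflect:
  fixes g :: "real \<Rightarrow> 'b::{banach, second_countable_topology}"
  assumes "g \<in> borel_measurable borel"
  shows "integrable \<mu> (\<lambda>x. g (- x)) \<longleftrightarrow> integrable \<mu> g"
  using integrable_distr_eq[of uminus \<mu> borel g] assms by (simp add: distr_mu_uminus)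

lemma AE_mu_reflect:
  assumes "AE x in \<mu>. P x"
  shows "AE x in \<mu>. P (- x)"
  using AE_distrD[of uminus \<mu> borel P] assms unfolding distr_mu_uminus by simp

lemma emeasure_mu_u_le:
  assumes r: "r \<ge> 0"
  shows "emeasure \<mu> {x. u x \<le> r} = ennreal (K * r powr (\<alpha> + 1) / (\<alpha> + 1))"
proof -
  define R where "R = r powr (real n / 2)"
  define e where "e = 2 * (\<alpha> + 1) / n - 1"
  define w where "w = (\<lambda>x. K / n * \<bar>x\<bar> powr e)"
  have e: "e > -1" using alpha_ge n by (simp add: e_def)
  have R: "R \<ge> 0" by (simp add: R_def)
  have set: "{x. u x \<le> r} = {-R..R}" unfolding u_le_iff[OF r] R_def by auto
  let ?I = "R powr (e+1) / (e+1)"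
  have 1: "((\<lambda>x. \<bar>x\<bar> powr e) has_integral ?I) {0..R}"
    using has_integral_powr_from_0[OF e R] by (rule has_integral_eq[rotated]) auto
  then have "((\<lambda>x. \<bar>-x\<bar> powr e) has_integral ?I) {-R..-0}"
    by (subst has_integral_reflect_real)
  then have "((\<lambda>x. \<bar>x\<bar> powr e) has_integral ?I + ?I) {-R..R}"
    using 1 R by (intro has_integral_combine[of "-R" 0 R]) auto
  then have "(w has_integral K / n * (?I + ?I)) {-R..R}"
    unfolding w_def by (rule has_integral_mult_right)
  then have "((\<lambda>x. indicator {-R..R} x * w x) has_integral K / n * (?I + ?I)) UNIV"
    by (subst (asm) has_integral_restrict_UNIV[symmetric]) (auto elim!: has_integral_eq[rotated] simp: indicator_def)
  then have "(\<integral>\<^sup>+ x. ennreal (indicator {-R..R} x * w x) \<partial>lborel) = ennreal (K / n * (?I + ?I))"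
    by (intro nn_integral_has_integral_lborel) (use K_pos in \<open>auto simp: w_def\<close>)
  moreover have "emeasure \<mu> {x. u x \<le> r} = (\<integral>\<^sup>+ x. ennreal (indicator {-R..R} x * w x) \<partial>lborel)"
    unfolding set mu_eq by (subst emeasure_density)
      (auto simp: w_def e_def indicator_def intro!: nn_integral_cong)
  moreover have "R powr (e + 1) = r powr (\<alpha> + 1)"
  proof -
    have "real n / 2 * (e + 1) = \<alpha> + 1" using n by (simp add: e_def)
    then show ?thesis by (simp only: R_def powr_powr)
  qed
  moreover have "e + 1 = 2 * (\<alpha> + 1) / n" by (simp add: e_def)
  moreover have "K / n * (X / (2 * (\<alpha> + 1) / n) + X / (2 * (\<alpha> + 1) / n)) = K * X / (\<alpha> + 1)" for X
    using n alpha_ge by (simp add: divide_simps)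
  ultimately show ?thesis by simp
qed

text \<open>The half lines \<open>{..r}\<close> form an intersection-stable generator, so comparing
  their masses replaces a change of variables.\<close>

lemma distr_mu_u: "distr \<mu> borel u = density lborel (\<lambda>y. ennreal (K * y powr \<alpha> * indicator {0..} y))"
proof (rule measure_eqI_generator_eq[where E = "range (\<lambda>r. {..r})" and \<Omega> = UNIV and A = "\<lambda>i. {..real i}"])
  have pre: "u -` {..r} = {x. u x \<le> r}" for r by auto
  have 1: "emeasure (distr \<mu> borel u) {..r} = (if r \<ge> 0 then ennreal (K * r powr (\<alpha> + 1) / (\<alpha> + 1)) else 0)" for r
  proof (cases "r \<ge> 0")
    case True
    then show ?thesis by (simp add: emeasure_distr pre emeasure_mu_u_le)
  next
    case False
    then have "{x. u x \<le> r} = {}" using u_nonneg by (auto simp: not_le intro: less_le_trans)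
    then show ?thesis using False by (simp add: emeasure_distr pre)
  qed
  show "emeasure (distr \<mu> borel u) X = emeasure (density lborel (\<lambda>y. ennreal (K * y powr \<alpha> * indicator {0..} y))) X"
    if "X \<in> range (\<lambda>r. {..r})" for X
  proof -
    obtain r where X: "X = {..r}" using \<open>X \<in> _\<close> by auto
    show ?thesis
    proof (cases "r \<ge> 0")
      case True
      have "((\<lambda>y. y powr \<alpha>) has_integral r powr (\<alpha>+1) / (\<alpha>+1)) {0..r}"
        using alpha_ge True by (intro has_integral_powr_from_0) auto
      then have "((\<lambda>y. K * y powr \<alpha>) has_integral K * (r powr (\<alpha>+1) / (\<alpha>+1))) {0..r}"
        by (rule has_integral_mult_right)
      then have "((\<lambda>y. K * y powr \<alpha> * indicator {0..r} y) has_integral K * (r powr (\<alpha>+1) / (\<alpha>+1))) UNIV"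
        by (subst (asm) has_integral_restrict_UNIV[symmetric]) (auto elim!: has_integral_eq[rotated] simp: indicator_def)
      then have "(\<integral>\<^sup>+ y. ennreal (K * y powr \<alpha> * indicator {0..r} y) \<partial>lborel) = ennreal (K * (r powr (\<alpha>+1) / (\<alpha>+1)))"
        by (intro nn_integral_has_integral_lborel) (use K_pos in auto)
      moreover have "emeasure (density lborel (\<lambda>y. ennreal (K * y powr \<alpha> * indicator {0..} y))) {..r}
          = (\<integral>\<^sup>+ y. ennreal (K * y powr \<alpha> * indicator {0..r} y) \<partial>lborel)"
        by (subst emeasure_density) (auto simp: indicator_def intro!: nn_integral_cong)
      ultimately show ?thesis using 1 X True by simp
    next
      case False
      then have "(\<lambda>y. ennreal (K * y powr \<alpha> * indicator {0..} y) * indicator {..r} y) = (\<lambda>y. 0)"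
        by (auto simp: indicator_def)
      then have "emeasure (density lborel (\<lambda>y. ennreal (K * y powr \<alpha> * indicator {0..} y))) {..r} = 0"
        by (subst emeasure_density) simp_all
      then show ?thesis using 1 X False by simp
    qed
  qed
  show "Int_stable (range (\<lambda>r::real. {..r}))"
    by (auto simp: Int_stable_def)
  show "sets (distr \<mu> borel u) = sigma_sets UNIV (range (\<lambda>r. {..r}))"
    "sets (density lborel (\<lambda>y. ennreal (K * y powr \<alpha> * indicator {0..} y))) = sigma_sets UNIV (range (\<lambda>r. {..r}))"
    by (simp_all add: borel_eq_atMost)
  show "(\<Union>i. {..real i}) = UNIV" by (auto intro: real_arch_simple)
  show "emeasure (distr \<mu> borel u) {..real i} \<noteq> \<infinity>" for i by (simp add: 1)
qed auto

lemma nn_integral_mu_u: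
  assumes [measurable]: "g \<in> borel_measurable borel"
  shows "(\<integral>\<^sup>+ x. g (u x) \<partial>\<mu>) = (\<integral>\<^sup>+ y. ennreal (K * y powr \<alpha> * indicator {0..} y) * g y \<partial>lborel)"
proof -
  have "(\<integral>\<^sup>+ x. g (u x) \<partial>\<mu>) = (\<integral>\<^sup>+ y. g y \<partial>distr \<mu> borel u)"
    by (rule nn_integral_distr[symmetric]) auto
  then show ?thesis unfolding distr_mu_u by (simp add: nn_integral_density)
qed

text \<open>Euler's integral for \<open>Gamma\<close>, rescaled by \<open>c\<close>, after transport
  to the half line.\<close>

lemma nn_integral_mu_exp_moment:
  assumes c: "c > 0"
  shows "(\<integral>\<^sup>+ x. ennreal (exp (- c * u x) * u x ^ m) \<partial>\<mu>) =
    ennreal (K * Gamma (\<alpha> + 1 + m) / c powr (\<alpha> + 1 + m))"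
proof -
  define s where "s = \<alpha> + 1 + m"
  have s: "s > 0" using alpha_ge by (simp add: s_def)
  let ?g = "\<lambda>t. ennreal (indicator {0..} t * t powr (s - 1) / exp t)"
  have "ennreal (Gamma s) = ennreal \<bar>c\<bar> * (\<integral>\<^sup>+ y. ?g (0 + c * y) \<partial>lborel)"
    unfolding Gamma_conv_nn_integral_real[OF s] using c by (intro nn_integral_real_affine) auto
  then have G: "ennreal (K / c powr s) * ennreal (Gamma s) = ennreal (K / c powr s) * ennreal \<bar>c\<bar> * (\<integral>\<^sup>+ y. ?g (0 + c * y) \<partial>lborel)"
    by (simp add: mult.assoc)
  also have "\<dots> = (\<integral>\<^sup>+ y. ennreal (K / c powr s) * ennreal \<bar>c\<bar> * ?g (0 + c * y) \<partial>lborel)"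
    by (rule nn_integral_cmult[symmetric]) auto
  also have "\<dots> = (\<integral>\<^sup>+ y. ennreal (K * y powr \<alpha> * indicator {0..} y) * ennreal (exp (- c * y) * y ^ m) \<partial>lborel)"
  proof (intro nn_integral_cong_AE)
    have "AE y in lborel. y \<noteq> (0::real)" by (rule AE_lborel_singleton)
    then show "AE y in lborel. ennreal (K / c powr s) * ennreal \<bar>c\<bar> * ?g (0 + c * y) =
        ennreal (K * y powr \<alpha> * indicator {0..} y) * ennreal (exp (- c * y) * y ^ m)"
    proof eventually_elim
      case (elim y)
      show ?case
      proof (cases "y > 0")
        case True
        have "K / c powr s * c * ((c * y) powr (s - 1) / exp (c * y)) = K * y powr \<alpha> * (exp (- c * y) * y ^ m)"
        proof -
          have "c powr s = c powr (s - 1) * c" using c powr_add[of c "s - 1" 1] by simp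
          moreover have "y powr (s - 1) = y powr \<alpha> * y ^ m"
            using True powr_add[of y \<alpha> m] by (simp add: s_def powr_realpow)
          ultimately show ?thesis using True c by (simp add: powr_mult exp_minus field_simps)
        qed
        then show ?thesis using True c K_pos
          by (simp add: ennreal_mult''[symmetric] ennreal_mult'[symmetric])
      next
        case False
        then have "y < 0" using elim by simp
        then have "c * y < 0" using c by (simp add: mult_less_0_iff)
        then show ?thesis using \<open>y < 0\<close> by simp
      qed
    qed
  qed
  also have "\<dots> = (\<integral>\<^sup>+ x. ennreal (exp (- c * u x) * u x ^ m) \<partial>\<mu>)"
    by (rule nn_integral_mu_u[symmetric]) auto
  finally show ?thesis using s K_pos c Gamma_real_pos[OF s]
    by (simp add: s_def ennreal_mult'[symmetric] flip: s_def)
qed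

lemma exp_moment_mu:
  assumes c: "c > 0"
  shows "integrable \<mu> (\<lambda>x. exp (- c * u x) * u x ^ m)"
    and "(LINT x|\<mu>. exp (- c * u x) * u x ^ m) = K * Gamma (\<alpha> + 1 + m) / c powr (\<alpha> + 1 + m)"
proof -
  have 0: "K * Gamma (\<alpha> + 1 + m) / c powr (\<alpha> + 1 + m) \<ge> 0"
    using K_pos alpha_ge by (auto intro!: divide_nonneg_nonneg mult_nonneg_nonneg less_imp_le[OF Gamma_real_pos])
  show "integrable \<mu> (\<lambda>x. exp (- c * u x) * u x ^ m)"
    using nn_integral_mu_exp_moment[OF c, of m] by (intro integrableI_nonneg) auto
  show "(LINT x|\<mu>. exp (- c * u x) * u x ^ m) = K * Gamma (\<alpha> + 1 + m) / c powr (\<alpha> + 1 + m)"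
    by (subst integral_eq_nn_integral) (use 0 nn_integral_mu_exp_moment[OF c] in auto)
qed

lemma emeasure_mu_tail: "emeasure \<mu> {x. u x > r} = \<infinity>"
proof (rule ccontr)
  assume fin: "emeasure \<mu> {x. u x > r} \<noteq> \<infinity>"
  define r0 where "r0 = max r 0"
  have "emeasure \<mu> {x. u x > r0} \<le> emeasure \<mu> {x. u x > r}"
    by (intro emeasure_mono) (auto simp: r0_def)
  then have fin0: "emeasure \<mu> {x. u x > r0} \<noteq> \<infinity>" using fin by (auto simp: top_unique)
  have un: "emeasure \<mu> {x. u x \<le> s} \<le> emeasure \<mu> {x. u x \<le> r0} + emeasure \<mu> {x. u x > r0}" for s
  proof -
    have "emeasure \<mu> {x. u x \<le> s} \<le> emeasure \<mu> ({x. u x \<le> r0} \<union> {x. u x > r0})"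
      by (intro emeasure_mono) auto
    also have "\<dots> \<le> emeasure \<mu> {x. u x \<le> r0} + emeasure \<mu> {x. u x > r0}"
      by (intro emeasure_subadditive) auto
    finally show ?thesis .
  qed
  define T where "T = emeasure \<mu> {x. u x \<le> r0} + emeasure \<mu> {x. u x > r0}"
  have "T \<noteq> \<infinity>" using fin0 by (simp add: T_def emeasure_mu_u_le r0_def)
  then obtain t where t: "T = ennreal t" "t \<ge> 0" by (cases T) auto
  have a1: "\<alpha> + 1 > 0" using alpha_ge by simp
  \<comment> \<open>The radius for which \<open>{x. u x \<le> s}\<close> has mass
    \<open>t + 1\<close>, more than the supposed bound \<open>t\<close> on all these masses.\<close>
  define s where "s = ((t + 1) * (\<alpha> + 1) / K) powr (1 / (\<alpha> + 1))"
  have pos: "(t + 1) * (\<alpha> + 1) / K > 0" using t a1 K_pos by simp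
  have "s powr (\<alpha> + 1) = (t + 1) * (\<alpha> + 1) / K"
    unfolding s_def powr_powr using pos a1 t K_pos by simp
  then have "K * s powr (\<alpha> + 1) / (\<alpha> + 1) = t + 1" using a1 K_pos by simp
  then have "emeasure \<mu> {x. u x \<le> s} = ennreal (t + 1)"
    using emeasure_mu_u_le[of s] by (simp add: s_def)
  with un[of s] show False unfolding T_def[symmetric] t using t by (simp add: ennreal_le_iff)
qed

text \<open>The common source of contradictions below: it excludes nonconstant polynomials, nonzero
  odd terms and linear relations between Gaussians.\<close>

lemma integrable_imp_not_ge_1_tail:
  assumes V: "integrable \<mu> V" and ge: "AE x in \<mu>. u x > r \<longrightarrow> 1 \<le> (V x :: real)"
  shows False
proof -
  have "emeasure \<mu> {x. u x > r} = (\<integral>\<^sup>+ x. indicator {x. u x > r} x \<partial>\<mu>)"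
    by (rule nn_integral_indicator[symmetric]) auto
  also have "\<dots> \<le> (\<integral>\<^sup>+ x. norm (V x) \<partial>\<mu>)"
  proof (rule nn_integral_mono_AE)
    show "AE x in \<mu>. indicator {x. u x > r} x \<le> ennreal (norm (V x))"
      using ge
    proof eventually_elim
      case (elim x)
      have "u x > r \<Longrightarrow> ennreal 1 \<le> ennreal (norm (V x))" using elim by (intro ennreal_leI) auto
      then show ?case by (simp add: indicator_def)
    qed
  qed
  also have "\<dots> < \<infinity>" using V by (simp add: integrable_iff_bounded)
  finally show False by (simp add: emeasure_mu_tail)
qed

end

subsection \<open>Termwise integration of the kernel\<close>

lemma pochhammer_mono_real:
  fixes a b :: real
  assumes "0 < a" "a \<le> b"
  shows "pochhammer a m \<le> pochhammer b m"
proof (induction m)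
  case (Suc m)
  then show ?case using assms
    by (auto simp: pochhammer_Suc intro!: mult_mono pochhammer_nonneg)
qed simp

lemma half_power_le_pochhammer:
  fixes a :: real
  assumes "1/2 \<le> a"
  shows "(1/2) ^ m \<le> pochhammer a m"
proof (induction m)
  case (Suc m)
  have "(1/2) ^ m * (1/2) \<le> pochhammer a m * (a + real m)"
    using Suc assms by (intro mult_mono pochhammer_nonneg) auto
  then show ?case by (simp add: pochhammer_Suc)
qed simp

text \<open>Brings the moment bound \<open>fact m / c ^ m\<close> of the integrable part into the
  form of the Gaussian moments, at a loss linear in \<open>m\<close>. The induction rests on
  \<open>(m + 1)\<^sup>2 \<le> (m + 2) * (m + 1/2)\<close>.\<close>

lemma fact_le_pochhammer:
  fixes a :: real
  assumes "1/2 \<le> a"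
  shows "fact m \<le> 2 * (real m + 1) * pochhammer a m"
proof (induction m)
  case (Suc m)
  have p: "pochhammer a m \<ge> 0" using assms by (intro pochhammer_nonneg) auto
  have "fact (Suc m) = (real m + 1) * fact m" by (simp add: algebra_simps)
  also have "\<dots> \<le> (real m + 1) * (2 * (real m + 1) * pochhammer a m)"
    using Suc by (intro mult_left_mono) auto
  also have "\<dots> = (2 * (real m + 1)\<^sup>2) * pochhammer a m" by (simp add: power2_eq_square)
  also have "\<dots> \<le> (2 * (real m + 2) * (a + real m)) * pochhammer a m"
  proof (rule mult_right_mono[OF _ p])
    have "(real m + 1)\<^sup>2 \<le> (real m + 2) * (1/2 + real m)"
      by (simp add: power2_eq_square algebra_simps)
    also have "\<dots> \<le> (real m + 2) * (a + real m)" using assms by (intro mult_left_mono) auto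
    finally show "2 * (real m + 1)\<^sup>2 \<le> 2 * (real m + 2) * (a + real m)"
      by (simp only: mult.assoc mult_le_cancel_left_pos zero_less_numeral)
  qed
  finally show ?case by (simp add: pochhammer_Suc algebra_simps)
qed simp

lemma sums_Suc_power_fact:
  fixes y :: real
  shows "(\<lambda>m. (real m + 1) * y ^ m / fact m) sums ((1 + y) * exp y)"
proof -
  note e = exp_sums[of y]
  have "(\<lambda>m. y * (y ^ m / fact m)) sums (y * exp y)" by (rule sums_mult[OF e])
  moreover have "y * (y ^ m / fact m) = real (Suc m) * y ^ Suc m / fact (Suc m)" for m
    by (simp add: divide_simps)
  ultimately have "(\<lambda>m. real (Suc m) * y ^ Suc m / fact (Suc m)) sums (y * exp y)" by simp
  then have "(\<lambda>m. real m * y ^ m / fact m) sums (y * exp y)"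
    by (subst (asm) sums_Suc_iff) simp
  from sums_add[OF this e] show ?thesis by (simp add: algebra_simps add_divide_distrib)
qed

text \<open>The factor \<open>real m + 1\<close> in the coefficients costs one factor
  \<open>1 + B * norm w\<close>, by \<open>sums_Suc_power_fact\<close>.\<close>

lemma exp_type_powser:
  fixes cf :: "nat \<Rightarrow> complex"
  assumes "A \<ge> 0" "B \<ge> 0" and cf: "\<And>m. norm (cf m) \<le> A * ((real m + 1) * B ^ m / fact m)"
  shows "summable (\<lambda>m. cf m * w ^ m)"
    and "(\<lambda>w. \<Sum>m. cf m * w ^ m) holomorphic_on UNIV"
    and "norm (\<Sum>m. cf m * w ^ m) \<le> A * (1 + B * norm w) * exp (B * norm w)"
proof -
  have le: "norm (cf m * w ^ m) \<le> A * ((real m + 1) * (B * norm w) ^ m / fact m)" for m w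
    using mult_right_mono[OF cf[of m], of "norm w ^ m"]
    by (simp add: norm_mult norm_power power_mult_distrib mult_ac)
  have sums: "(\<lambda>m. A * ((real m + 1) * (B * norm w) ^ m / fact m)) sums (A * ((1 + B * norm w) * exp (B * norm w)))" for w :: complex
    by (intro sums_mult sums_Suc_power_fact)
  show sum: "summable (\<lambda>m. cf m * w ^ m)" for w
    by (rule summable_comparison_test'[OF sums_summable[OF sums]]) (rule le)
  have "(\<lambda>w. \<Sum>m. cf m * w ^ m) holomorphic_on ball 0 r" for r
    using sum by (intro power_series_holomorphic[where a = cf]) (auto simp: summable_sums)
  then have "(\<lambda>w. \<Sum>m. cf m * w ^ m) holomorphic_on (\<Union>r. ball 0 r)"
    by (intro holomorphic_on_UN_open) auto
  moreover have "(\<Union>r. ball (0::complex) r) = UNIV"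
    by (auto intro: gt_ex)
  ultimately show "(\<lambda>w. \<Sum>m. cf m * w ^ m) holomorphic_on UNIV" by simp
  have "norm (\<Sum>m. cf m * w ^ m) \<le> (\<Sum>m. A * ((real m + 1) * (B * norm w) ^ m / fact m))"
    by (rule norm_suminf_le[OF le sums_summable[OF sums]])
  then show "norm (\<Sum>m. cf m * w ^ m) \<le> A * (1 + B * norm w) * exp (B * norm w)"
    using sums_unique[OF sums[of w]] by (simp add: mult.assoc)
qed

context kn_weight
begin

text \<open>The coefficients of \<open>bessel_j \<beta> (n * \<bar>l * x\<bar> powr (1 / n))\<close>
  as a power series in \<open>u l * u x\<close>; the quotient of Gamma values is written as a
  Pochhammer symbol.\<close>

definition bcoef :: "real \<Rightarrow> nat \<Rightarrow> real" where
  "bcoef \<beta> m = (-1) ^ m * (real n / 2) ^ (2 * m) / (fact m * pochhammer (\<beta> + 1) m)"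

lemma bcoef_nonzero: "\<beta> \<ge> -1/2 \<Longrightarrow> bcoef \<beta> m \<noteq> 0"
  using n pochhammer_pos[of "\<beta> + 1" m] by (simp add: bcoef_def)

lemma abs_bcoef:
  assumes "\<beta> \<ge> -1/2"
  shows "\<bar>bcoef \<beta> m\<bar> = ((real n)\<^sup>2 / 4) ^ m / (fact m * pochhammer (\<beta> + 1) m)"
  using assms pochhammer_pos[of "\<beta> + 1" m]
  by (simp add: bcoef_def abs_mult power_abs power_mult power_divide)

text \<open>A crude bound, sufficient for the convergence of the kernel series; the sharp rate
  \<open>B\<close> needs the exact value in \<open>abs_bcoef\<close>.\<close>

lemma abs_bcoef_le:
  assumes "\<beta> \<ge> -1/2"
  shows "\<bar>bcoef \<beta> m\<bar> \<le> ((real n)\<^sup>2 / 2) ^ m / fact m"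
proof -
  have "1 / pochhammer (\<beta> + 1) m \<le> 1 / (1/2) ^ m"
    using assms by (intro divide_left_mono half_power_le_pochhammer mult_pos_pos pochhammer_pos) auto
  then have "((real n)\<^sup>2 / 4) ^ m / fact m * (1 / pochhammer (\<beta> + 1) m) \<le> ((real n)\<^sup>2 / 4) ^ m / fact m * (1 / (1/2) ^ m)"
    by (intro mult_left_mono) auto
  also have "\<dots> = ((real n)\<^sup>2 / 4 * 2) ^ m / fact m"
    unfolding power_mult_distrib by (simp add: power_one_over)
  finally show ?thesis by (simp add: abs_bcoef[OF assms])
qed

lemma bcoef_summable:
  assumes "\<beta> \<ge> -1/2"
  shows "summable (\<lambda>m. \<bar>bcoef \<beta> m * y ^ m\<bar>)"
proof (rule summable_comparison_test')
  show "summable (\<lambda>m. ((real n)\<^sup>2 / 2 * \<bar>y\<bar>) ^ m / fact m)"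
    using exp_sums by (rule sums_summable)
  show "norm \<bar>bcoef \<beta> m * y ^ m\<bar> \<le> ((real n)\<^sup>2 / 2 * \<bar>y\<bar>) ^ m / fact m" for m
    using mult_right_mono[OF abs_bcoef_le[OF assms, of m], of "\<bar>y\<bar> ^ m"]
    unfolding power_mult_distrib by (simp add: abs_mult power_abs)
qed

lemma bessel_j_eq_suminf:
  assumes "\<beta> \<ge> -1/2"
  shows "bessel_j \<beta> (real n * \<bar>l * x\<bar> powr (1 / real n)) = (\<Sum>m. bcoef \<beta> m * (u l * u x) ^ m)"
proof -
  define z where "z = \<bar>l * x\<bar> powr (1 / real n)"
  have z2: "z\<^sup>2 = u l * u x"
    unfolding u_mult[symmetric] by (simp add: z_def u_def power2_eq_square flip: powr_add)
  have G: "Gamma (\<beta> + 1) > 0" using assms by (intro Gamma_real_pos) auto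
  have summand: "(-1) ^ m / (fact m * Gamma (\<beta> + real m + 1)) * (real n * z / 2) ^ (2 * m)
      = 1 / Gamma (\<beta> + 1) * (bcoef \<beta> m * (u l * u x) ^ m)" for m
  proof -
    have "\<beta> + 1 \<notin> \<int>\<^sub>\<le>\<^sub>0" using assms by (auto elim!: nonpos_Ints_cases)
    then have "pochhammer (\<beta> + 1) m = Gamma (\<beta> + real m + 1) / Gamma (\<beta> + 1)"
      by (subst pochhammer_Gamma) (auto simp: add_ac)
    moreover have "(real n * z / 2) ^ (2 * m) = (real n / 2) ^ (2 * m) * (u l * u x) ^ m"
      by (simp add: z2[symmetric] power_mult[symmetric] power_mult_distrib power_divide)
    ultimately show ?thesis using G by (simp add: bcoef_def)
  qed
  have s: "summable (\<lambda>m. bcoef \<beta> m * (u l * u x) ^ m)"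
    using bcoef_summable[OF assms] by (rule summable_rabs_cancel)
  show ?thesis unfolding bessel_j_def z_def[symmetric] summand
    using G by (subst suminf_mult[OF s]) simp
qed

text \<open>\<open>bd\<close> makes the integrals of the absolute values of the terms summable for
  every \<open>l\<close>, which justifies integrating the kernel series term by term.\<close>

lemma integral_bessel_j:
  fixes F :: "real \<Rightarrow> complex"
  assumes \<beta>: "\<beta> \<ge> -1/2" and [measurable]: "F \<in> borel_measurable borel" and AB: "A \<ge> 0" "B \<ge> 0"
    and int: "\<And>m. integrable \<mu> (\<lambda>x. norm (F x) * u x ^ m)"
    and bd: "\<And>m. \<bar>bcoef \<beta> m\<bar> * (LINT x|\<mu>. norm (F x) * u x ^ m) \<le> A * ((real m + 1) * B ^ m / fact m)"
  defines "cf \<equiv> \<lambda>m. of_real (bcoef \<beta> m) * (LINT x|\<mu>. F x * of_real (u x ^ m))"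
  shows "integrable \<mu> (\<lambda>x. F x * of_real (bessel_j \<beta> (real n * \<bar>l * x\<bar> powr (1 / real n))))"
    and "(LINT x|\<mu>. F x * of_real (bessel_j \<beta> (real n * \<bar>l * x\<bar> powr (1 / real n)))) = (\<Sum>m. cf m * of_real (u l) ^ m)"
    and "norm (cf m) \<le> A * ((real m + 1) * B ^ m / fact m)"
proof -
  define h where "h = (\<lambda>m x. F x * of_real (bcoef \<beta> m * (u l * u x) ^ m))"
  have int': "integrable \<mu> (\<lambda>x. F x * of_real (u x ^ m))" for m
    by (rule Bochner_Integration.integrable_bound[OF int[of m]]) (auto simp: norm_mult norm_power)
  have h_eq: "h m = (\<lambda>x. of_real (bcoef \<beta> m * u l ^ m) * (F x * of_real (u x ^ m)))" for m
    by (auto simp: h_def power_mult_distrib)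
  have norm_h: "norm (h m x) = \<bar>bcoef \<beta> m\<bar> * u l ^ m * (norm (F x) * u x ^ m)" for m x
    by (simp add: h_eq norm_mult norm_power abs_mult)
  have h_int: "integrable \<mu> (h m)" for m unfolding h_eq using int' by auto
  have summ: "summable (\<lambda>m. norm (h m x))" for x
    using summable_mult[OF bcoef_summable[OF \<beta>, of "u l * u x"], of "norm (F x)"]
    by (simp add: h_def norm_mult norm_power abs_mult power_mult_distrib)
  have summ2: "summable (\<lambda>m. LINT x|\<mu>. norm (h m x))"
  proof (rule summable_comparison_test')
    show "summable (\<lambda>m. A * ((real m + 1) * (B * u l) ^ m / fact m))"
      using sums_mult[OF sums_Suc_power_fact[of "B * u l"], of A] by (rule sums_summable)
    fix m
    have "(LINT x|\<mu>. norm (h m x)) = \<bar>bcoef \<beta> m\<bar> * (LINT x|\<mu>. norm (F x) * u x ^ m) * u l ^ m"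
      unfolding norm_h by simp
    also have "\<dots> \<le> A * ((real m + 1) * B ^ m / fact m) * u l ^ m"
      by (intro mult_right_mono bd) auto
    finally show "norm (LINT x|\<mu>. norm (h m x)) \<le> A * ((real m + 1) * (B * u l) ^ m / fact m)"
      by (simp add: power_mult_distrib mult_ac integral_nonneg_AE)
  qed
  have sum_h: "(\<Sum>m. h m x) = F x * of_real (bessel_j \<beta> (real n * \<bar>l * x\<bar> powr (1 / real n)))" for x
  proof -
    have s: "summable (\<lambda>m. bcoef \<beta> m * (u l * u x) ^ m)"
      using bcoef_summable[OF \<beta>] by (rule summable_rabs_cancel)
    then have "(\<lambda>m. complex_of_real (bcoef \<beta> m * (u l * u x) ^ m)) sums
        of_real (bessel_j \<beta> (real n * \<bar>l * x\<bar> powr (1 / real n)))"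
      unfolding bessel_j_eq_suminf[OF \<beta>] by (intro sums_of_real summable_sums)
    from sums_mult[OF this, of "F x"] show ?thesis by (simp add: h_def sums_iff)
  qed
  show "integrable \<mu> (\<lambda>x. F x * of_real (bessel_j \<beta> (real n * \<bar>l * x\<bar> powr (1 / real n))))"
    using integrable_suminf[OF h_int _ summ2] summ by (simp add: sum_h)
  have "(LINT x|\<mu>. (\<Sum>m. h m x)) = (\<Sum>m. LINT x|\<mu>. h m x)"
    using integral_suminf[OF h_int _ summ2] summ by simp
  moreover have "(LINT x|\<mu>. h m x) = cf m * of_real (u l) ^ m" for m
    unfolding h_eq by (subst integral_mult_right_zero) (simp add: cf_def mult_ac)
  ultimately show "(LINT x|\<mu>. F x * of_real (bessel_j \<beta> (real n * \<bar>l * x\<bar> powr (1 / real n)))) = (\<Sum>m. cf m * of_real (u l) ^ m)"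
    by (simp add: sum_h)
  have "norm (LINT x|\<mu>. F x * of_real (u x ^ m)) \<le> (LINT x|\<mu>. norm (F x) * u x ^ m)"
    using integral_norm_bound[of \<mu> "\<lambda>x. F x * of_real (u x ^ m)"] by (simp add: norm_mult norm_power)
  then have "norm (cf m) \<le> \<bar>bcoef \<beta> m\<bar> * (LINT x|\<mu>. norm (F x) * u x ^ m)"
    by (simp add: cf_def norm_mult mult_left_mono)
  then show "norm (cf m) \<le> A * ((real m + 1) * B ^ m / fact m)" using bd by (rule order_trans)
qed

text \<open>A common weakening of \<open>h \<in> L\<^sup>p\<close> for all \<open>p \<ge> 1\<close>, by \<open>t \<le> 1 + t powr p\<close>; it replaces
  every use of Hoelder's inequality.\<close>

definition dominated :: "(real \<Rightarrow> complex) \<Rightarrow> bool" where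
  "dominated h \<longleftrightarrow> (\<exists>D V. D \<ge> 0 \<and> integrable \<mu> V \<and> (\<forall>x. V x \<ge> 0) \<and> (AE x in \<mu>. norm (h x) \<le> D + V x))"

lemma Lp_finite_imp_dominated:
  assumes [measurable]: "h \<in> borel_measurable borel" and p: "1 \<le> p" and L: "Lp_finite \<mu> p h"
  shows "dominated h"
proof (cases "p = \<infinity>")
  case True
  then obtain C where "AE x in \<mu>. norm (h x) \<le> C" using L by (auto simp: Lp_finite_def)
  then show ?thesis unfolding dominated_def
    by (intro exI[of _ "\<bar>C\<bar>"] exI[of _ "\<lambda>_. 0"]) auto
next
  case False
  define r where "r = real_of_ereal p"
  have r: "r \<ge> 1" using p False by (cases p) (auto simp: r_def)
  have "integrable \<mu> (\<lambda>x. norm (h x) powr r)"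
    using L False by (intro integrableI_nonneg) (auto simp: Lp_finite_def r_def)
  moreover have "y \<le> 1 + y powr r" if "y \<ge> 0" for y :: real
  proof (cases "y \<le> 1")
    case False
    then have "y powr 1 \<le> y powr r" using r by (intro powr_mono) auto
    then show ?thesis using that False by simp
  qed (simp add: add_increasing2)
  ultimately show ?thesis unfolding dominated_def
    by (intro exI[of _ 1] exI[of _ "\<lambda>x. norm (h x) powr r"]) auto
qed


text \<open>Absorbs the factor \<open>x\<close> of the odd kernel part into moments in
  \<open>u\<close>, raising their order by \<open>n\<close>.\<close>

lemma abs_le_Suc_u_power: "\<bar>x\<bar> \<le> 1 + u x ^ n"
proof (cases "u x \<le> 1")
  case True
  then have "\<bar>x\<bar> \<le> 1" using u_le_iff[of 1 x] by simp
  then show ?thesis by (simp add: add_increasing2)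
next
  case False
  then have "u x powr (real n / 2) \<le> u x powr real n" by (intro powr_mono) auto
  then show ?thesis using False abs_eq_u_powr[of x] by (simp add: powr_realpow)
qed

text \<open>Here \<open>norm (f x) \<le> (D + V x) * exp (- c * u x)\<close>. The constant
  contributes Gaussian moments, the integrable part at most \<open>fact m / c ^ m\<close> times its
  integral, since \<open>y ^ m * exp (- c * y) \<le> fact m / c ^ m\<close>.\<close>

lemma dominated_moments:
  fixes f :: "real \<Rightarrow> complex"
  assumes [measurable]: "f \<in> borel_measurable borel" and c: "c > 0"
    and dom: "dominated (\<lambda>x. of_real (exp (c * u x)) * f x)"
  obtains A where "A \<ge> 0" and "\<And>m. integrable \<mu> (\<lambda>x. norm (f x) * u x ^ m)"
    and "\<And>m. (LINT x|\<mu>. norm (f x) * u x ^ m) \<le> A * ((real m + 1) * pochhammer (\<alpha> + 1) m / c ^ m)"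
proof -
  obtain D V where D: "D \<ge> 0" and V: "integrable \<mu> V" "\<And>x. V x \<ge> 0"
    and le: "AE x in \<mu>. norm (of_real (exp (c * u x)) * f x) \<le> D + V x"
    using dom unfolding dominated_def by auto
  define A where "A = D * K * Gamma (\<alpha> + 1) / c powr (\<alpha> + 1) + 2 * (LINT x|\<mu>. V x)"
  define W where "W = (\<lambda>m x. D * (exp (- c * u x) * u x ^ m) + fact m / c ^ m * V x)"
  have W_int: "integrable \<mu> (W m)" for m unfolding W_def using V exp_moment_mu(1)[OF c, of m] by auto
  have le': "AE x in \<mu>. norm (f x) * u x ^ m \<le> W m x" for m
    using le
  proof eventually_elim
    case (elim x)
    have "norm (f x) * exp (c * u x) \<le> D + V x" using elim by (simp add: norm_mult mult.commute)
    then have "norm (f x) \<le> (D + V x) * exp (- c * u x)"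
      by (simp add: exp_minus field_simps)
    then have "norm (f x) * u x ^ m \<le> (D + V x) * exp (- c * u x) * u x ^ m"
      by (intro mult_right_mono) auto
    also have "\<dots> = D * (exp (- c * u x) * u x ^ m) + V x * (exp (- c * u x) * u x ^ m)"
      by (simp add: algebra_simps)
    also have "V x * (exp (- c * u x) * u x ^ m) \<le> V x * (fact m / c ^ m)"
    proof (rule mult_left_mono)
      have "(c * u x) ^ m \<le> fact m * exp (c * u x)" using c by (intro power_le_fact_mult_exp) auto
      then show "exp (- c * u x) * u x ^ m \<le> fact m / c ^ m"
        using c by (simp add: power_mult_distrib exp_minus field_simps)
    qed (use V in auto)
    finally show ?case by (simp add: W_def mult.commute)
  qed
  have int: "integrable \<mu> (\<lambda>x. norm (f x) * u x ^ m)" for m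
  proof (rule Bochner_Integration.integrable_bound[OF W_int[of m]])
    show "AE x in \<mu>. norm (norm (f x) * u x ^ m) \<le> norm (W m x)"
      using le'[of m] by eventually_elim simp
  qed measurable
  have p: "pochhammer (\<alpha> + 1) m > 0" for m using alpha_ge by (intro pochhammer_pos) auto
  show ?thesis
  proof (rule that[OF _ int])
    have G: "Gamma (\<alpha> + 1) > 0" using alpha_ge by (intro Gamma_real_pos) auto
    have V0: "(LINT x|\<mu>. V x) \<ge> 0" using V by (intro integral_nonneg_AE) auto
    have D0: "D * K * Gamma (\<alpha> + 1) / c powr (\<alpha> + 1) \<ge> 0" using D K_pos G by simp
    show "A \<ge> 0" using V0 D0 by (simp add: A_def)
    fix m
    have "\<alpha> + 1 \<notin> \<int>\<^sub>\<le>\<^sub>0" using alpha_ge by (auto elim!: nonpos_Ints_cases)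
    then have Gm: "Gamma (\<alpha> + 1 + m) = Gamma (\<alpha> + 1) * pochhammer (\<alpha> + 1) m"
      using G by (simp add: pochhammer_Gamma)
    have cm: "c powr (\<alpha> + 1 + m) = c powr (\<alpha> + 1) * c ^ m"
      using c by (simp only: powr_add powr_realpow)
    have "(LINT x|\<mu>. norm (f x) * u x ^ m) \<le> (LINT x|\<mu>. W m x)"
      by (rule integral_mono_AE[OF int W_int le'])
    also have "\<dots> = D * (K * Gamma (\<alpha> + 1 + m) / c powr (\<alpha> + 1 + m)) + fact m / c ^ m * (LINT x|\<mu>. V x)"
      unfolding W_def using V exp_moment_mu[OF c, of m] by simp
    also have "\<dots> = (D * K * Gamma (\<alpha> + 1) / c powr (\<alpha> + 1)) * (1 * pochhammer (\<alpha> + 1) m / c ^ m)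
        + (LINT x|\<mu>. V x) * (fact m / c ^ m)"
      unfolding Gm cm by (simp add: mult_ac)
    also have "\<dots> \<le> (D * K * Gamma (\<alpha> + 1) / c powr (\<alpha> + 1)) * ((real m + 1) * pochhammer (\<alpha> + 1) m / c ^ m)
        + (LINT x|\<mu>. V x) * (2 * (real m + 1) * pochhammer (\<alpha> + 1) m / c ^ m)"
      using c p[of m] alpha_ge
      by (intro add_mono mult_left_mono[OF _ D0] mult_left_mono[OF _ V0] divide_right_mono fact_le_pochhammer
            mult_right_mono) auto
    also have "\<dots> = A * ((real m + 1) * pochhammer (\<alpha> + 1) m / c ^ m)"
      by (simp add: A_def algebra_simps add_divide_distrib)
    finally show "(LINT x|\<mu>. norm (f x) * u x ^ m) \<le> A * ((real m + 1) * pochhammer (\<alpha> + 1) m / c ^ m)" .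
  qed
qed

lemma dominated_coeff_integrable:
  fixes f :: "real \<Rightarrow> complex"
  assumes [measurable]: "f \<in> borel_measurable borel" and c: "c > 0"
    and dom: "dominated (\<lambda>x. of_real (exp (c * u x)) * f x)"
  shows "integrable \<mu> (\<lambda>x. f x * of_real (u x ^ m))"
    and "integrable \<mu> (\<lambda>x. (of_real x * f x) * of_real (u x ^ m))"
proof -
  obtain A where mom: "\<And>m. integrable \<mu> (\<lambda>x. norm (f x) * u x ^ m)"
    using dominated_moments[OF assms(1) c dom] by metis
  show "integrable \<mu> (\<lambda>x. f x * of_real (u x ^ m))"
    by (rule Bochner_Integration.integrable_bound[OF mom[of m]]) (auto simp: norm_mult norm_power)
  show "integrable \<mu> (\<lambda>x. (of_real x * f x) * of_real (u x ^ m))"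
  proof (rule Bochner_Integration.integrable_bound)
    show "integrable \<mu> (\<lambda>x. norm (f x) * u x ^ m + norm (f x) * u x ^ (m + n))" using mom by auto
    show "AE x in \<mu>. norm (of_real x * f x * of_real (u x ^ m)) \<le> norm (norm (f x) * u x ^ m + norm (f x) * u x ^ (m + n))"
    proof (intro AE_I2)
      fix x
      have "\<bar>x\<bar> * (norm (f x) * u x ^ m) \<le> (1 + u x ^ n) * (norm (f x) * u x ^ m)"
        by (intro mult_right_mono abs_le_Suc_u_power) auto
      then show "norm (of_real x * f x * of_real (u x ^ m)) \<le> norm (norm (f x) * u x ^ m + norm (f x) * u x ^ (m + n))"
        by (simp add: norm_mult norm_power algebra_simps power_add)
    qed
  qed measurable
qed

text \<open>With \<open>odd_coeff\<close> and \<open>odd_factor\<close> below: the Taylor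
  coefficients of the G and H of the overview, and the constant in front of
  \<open>l * H\<close>.\<close>

definition even_coeff :: "(real \<Rightarrow> complex) \<Rightarrow> nat \<Rightarrow> complex" where
  "even_coeff f m = of_real (bcoef \<alpha> m) * (LINT x|\<mu>. f x * of_real (u x ^ m))"

definition odd_coeff :: "(real \<Rightarrow> complex) \<Rightarrow> nat \<Rightarrow> complex" where
  "odd_coeff f m = of_real (bcoef (\<alpha> + n) m) * (LINT x|\<mu>. (of_real x * f x) * of_real (u x ^ m))"

definition odd_factor :: complex where
  "odd_factor = (- \<i>) ^ n * of_real ((real n / 2) ^ n * Gamma (\<alpha> + 1) / Gamma (\<alpha> + real n + 1))"

lemma odd_factor_nonzero: "odd_factor \<noteq> 0"
proof -
  have "Gamma (\<alpha> + 1) > 0" "Gamma (\<alpha> + real n + 1) > 0"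
    using alpha_ge by (auto intro!: Gamma_real_pos)
  then have "(real n / 2) ^ n * Gamma (\<alpha> + 1) / Gamma (\<alpha> + real n + 1) \<noteq> 0" using n by auto
  then show ?thesis unfolding odd_factor_def by (simp only: mult_eq_0_iff of_real_eq_0_iff power_eq_0_iff) auto
qed

lemma F_kn_expansion:
  fixes f :: "real \<Rightarrow> complex"
  assumes [measurable]: "f \<in> borel_measurable borel" and c: "c > 0"
    and dom: "dominated (\<lambda>x. of_real (exp (c * u x)) * f x)"
  defines "B \<equiv> (real n)\<^sup>2 / (4 * c)"
  obtains A where "A \<ge> 0"
    and "\<And>m. norm (even_coeff f m) \<le> A * ((real m + 1) * B ^ m / fact m)"
    and "\<And>m. norm (odd_coeff f m) \<le> A * ((real m + 1) * B ^ m / fact m)"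
    and "\<And>l. F_kn k n f l = (\<Sum>m. even_coeff f m * of_real (u l) ^ m)
          + odd_factor * of_real l * (\<Sum>m. odd_coeff f m * of_real (u l) ^ m)"
proof -
  obtain A where A: "A \<ge> 0" and int: "\<And>m. integrable \<mu> (\<lambda>x. norm (f x) * u x ^ m)"
    and le: "\<And>m. (LINT x|\<mu>. norm (f x) * u x ^ m) \<le> A * ((real m + 1) * pochhammer (\<alpha> + 1) m / c ^ m)"
    using dominated_moments[OF assms(1) c dom] by metis
  have a: "\<alpha> \<ge> -1/2" "\<alpha> + n \<ge> -1/2" using alpha_ge by auto
  have B: "B \<ge> 0" using c by (simp add: B_def)
  have p: "pochhammer (\<alpha> + 1) m > 0" "pochhammer (\<alpha> + n + 1) m > 0" for m
    using a by (auto intro!: pochhammer_pos)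
  \<comment> \<open>Thus \<open>c ^ m\<close> and the Pochhammer symbol of the moment bound cancel
    against \<open>abs_bcoef\<close>.\<close>
  have Bm: "((real n)\<^sup>2 / 4) ^ m = B ^ m * c ^ m" for m
    using c by (simp add: B_def power_mult_distrib[symmetric])
  have even: "\<bar>bcoef \<alpha> m\<bar> * (LINT x|\<mu>. norm (f x) * u x ^ m) \<le> A * ((real m + 1) * B ^ m / fact m)" for m
  proof -
    have "\<bar>bcoef \<alpha> m\<bar> * (LINT x|\<mu>. norm (f x) * u x ^ m)
        \<le> \<bar>bcoef \<alpha> m\<bar> * (A * ((real m + 1) * pochhammer (\<alpha> + 1) m / c ^ m))"
      by (intro mult_left_mono le) auto
    also have "\<dots> = A * ((real m + 1) * B ^ m / fact m)"
      unfolding abs_bcoef[OF a(1)] Bm using c p[of m] by simp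
    finally show ?thesis .
  qed
  define g where "g = (\<lambda>x. of_real x * f x)"
  have [measurable]: "g \<in> borel_measurable borel" unfolding g_def by measurable
  \<comment> \<open>The factor \<open>x\<close> brings in moments of order \<open>m + n\<close>. In
    \<open>pochhammer (\<alpha> + 1) (m + n) = pochhammer (\<alpha> + 1) n * pochhammer (\<alpha> +
    n + 1) m\<close> the last factor cancels against the Bessel coefficient of index
    \<open>\<alpha> + n\<close>, so the constant grows but \<open>B\<close> stays.\<close>
  define A' where "A' = A * (1 + (real n + 1) * pochhammer (\<alpha> + 1) n / c ^ n)"
  have q0: "(real n + 1) * pochhammer (\<alpha> + 1) n / c ^ n \<ge> 0" using p[of n] c by simp
  have AA': "A \<le> A'"
    unfolding A'_def using mult_left_mono[OF _ A, of 1 "1 + (real n + 1) * pochhammer (\<alpha> + 1) n / c ^ n"] q0 by simp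
  have g_le: "norm (g x) * u x ^ m \<le> norm (f x) * u x ^ m + norm (f x) * u x ^ (m + n)" for x m
  proof -
    have "norm (g x) * u x ^ m = \<bar>x\<bar> * (norm (f x) * u x ^ m)" by (simp add: g_def norm_mult)
    also have "\<dots> \<le> (1 + u x ^ n) * (norm (f x) * u x ^ m)"
      by (intro mult_right_mono abs_le_Suc_u_power) auto
    finally show ?thesis by (simp add: algebra_simps power_add)
  qed
  have g_int: "integrable \<mu> (\<lambda>x. norm (g x) * u x ^ m)" for m
    by (rule Bochner_Integration.integrable_bound[where f = "\<lambda>x. norm (f x) * u x ^ m + norm (f x) * u x ^ (m + n)"])
       (use int g_le in \<open>auto simp: abs_mult\<close>)
  have odd: "\<bar>bcoef (\<alpha> + n) m\<bar> * (LINT x|\<mu>. norm (g x) * u x ^ m) \<le> A' * ((real m + 1) * B ^ m / fact m)" for m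
  proof -
    have "(LINT x|\<mu>. norm (g x) * u x ^ m) \<le> (LINT x|\<mu>. norm (f x) * u x ^ m + norm (f x) * u x ^ (m + n))"
      using int g_int g_le by (intro integral_mono) auto
    also have "\<dots> = (LINT x|\<mu>. norm (f x) * u x ^ m) + (LINT x|\<mu>. norm (f x) * u x ^ (m + n))"
      using int by simp
    also have "\<dots> \<le> A * ((real m + 1) * pochhammer (\<alpha> + 1) m / c ^ m)
        + A * ((real (m + n) + 1) * pochhammer (\<alpha> + 1) (m + n) / c ^ (m + n))"
      by (intro add_mono le)
    also have "\<dots> \<le> A * ((real m + 1) * pochhammer (\<alpha> + n + 1) m / c ^ m)
        + A * ((real m + 1) * (real n + 1) * (pochhammer (\<alpha> + 1) n * pochhammer (\<alpha> + n + 1) m) / (c ^ m * c ^ n))"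
    proof (intro add_mono mult_left_mono[OF _ A])
      show "(real m + 1) * pochhammer (\<alpha> + 1) m / c ^ m \<le> (real m + 1) * pochhammer (\<alpha> + n + 1) m / c ^ m"
        using c a by (intro divide_right_mono mult_left_mono pochhammer_mono_real) auto
      have "pochhammer (\<alpha> + 1) (m + n) = pochhammer (\<alpha> + 1) n * pochhammer (\<alpha> + n + 1) m"
        using pochhammer_product'[of "\<alpha> + 1" n m] by (simp add: add_ac)
      moreover have "real (m + n) + 1 \<le> (real m + 1) * (real n + 1)" by (simp add: algebra_simps)
      ultimately show "(real (m + n) + 1) * pochhammer (\<alpha> + 1) (m + n) / c ^ (m + n)
          \<le> (real m + 1) * (real n + 1) * (pochhammer (\<alpha> + 1) n * pochhammer (\<alpha> + n + 1) m) / (c ^ m * c ^ n)"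
        using c p[of n] p[of m] unfolding power_add by (auto intro!: divide_right_mono mult_right_mono)
    qed
    also have "\<dots> = A' * ((real m + 1) * pochhammer (\<alpha> + n + 1) m / c ^ m)"
      using c by (simp add: A'_def field_simps)
    finally have "\<bar>bcoef (\<alpha> + n) m\<bar> * (LINT x|\<mu>. norm (g x) * u x ^ m)
        \<le> \<bar>bcoef (\<alpha> + n) m\<bar> * (A' * ((real m + 1) * pochhammer (\<alpha> + n + 1) m / c ^ m))"
      by (intro mult_left_mono) auto
    also have "\<dots> = A' * ((real m + 1) * B ^ m / fact m)"
      unfolding abs_bcoef[OF a(2)] Bm using c p[of m] by simp
    finally show ?thesis .
  qed
  note E = integral_bessel_j[OF a(1) _ A B int even, folded even_coeff_def]
  have A': "A' \<ge> 0" using A AA' by simp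
  note O = integral_bessel_j[OF a(2) _ A' B g_int odd, unfolded g_def, folded odd_coeff_def]
  show ?thesis
  proof (rule that[OF A'])
    show "norm (even_coeff f m) \<le> A' * ((real m + 1) * B ^ m / fact m)" for m
    proof -
      have "A * ((real m + 1) * B ^ m / fact m) \<le> A' * ((real m + 1) * B ^ m / fact m)"
        using AA' B by (intro mult_right_mono) auto
      then show ?thesis using E(3)[of m] by simp
    qed
    show "norm (odd_coeff f m) \<le> A' * ((real m + 1) * B ^ m / fact m)" for m
      using O(3)[of m] by simp
    fix l
    let ?je = "\<lambda>x. bessel_j \<alpha> (real n * \<bar>l * x\<bar> powr (1 / real n))"
    let ?jo = "\<lambda>x. bessel_j (\<alpha> + n) (real n * \<bar>l * x\<bar> powr (1 / real n))"
    have "F_kn k n f l = (LINT x|\<mu>. f x * of_real (?je x) + odd_factor * of_real l * (of_real x * f x * of_real (?jo x)))"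
      unfolding F_kn_def B_kn_def odd_factor_def
      by (intro Bochner_Integration.integral_cong refl) (simp add: algebra_simps)
    also have "\<dots> = (LINT x|\<mu>. f x * of_real (?je x)) + odd_factor * of_real l * (LINT x|\<mu>. of_real x * f x * of_real (?jo x))"
      using E(1)[of l] O(1)[of l] by simp
    finally show "F_kn k n f l = (\<Sum>m. even_coeff f m * of_real (u l) ^ m)
          + odd_factor * of_real l * (\<Sum>m. odd_coeff f m * of_real (u l) ^ m)"
      using E(2)[of l] O(2)[of l] by simp
  qed
qed

subsection \<open>Gaussians\<close>

definition gauss :: "real \<Rightarrow> real \<Rightarrow> complex" where
  "gauss c x = of_real (exp (- c * u x))"

lemma measurable_gauss [measurable]: "gauss c \<in> borel_measurable borel"
  unfolding gauss_def by measurable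

lemma dominated_gauss: "dominated (\<lambda>x. of_real (exp (c * u x)) * gauss c x)"
  unfolding dominated_def gauss_def by (intro exI[of _ 1] exI[of _ "\<lambda>_. 0"]) (auto simp: exp_minus)

text \<open>The total mass of \<open>gauss c\<close>, hence the value of its transform at 0.\<close>

definition gauss_const :: "real \<Rightarrow> real" where
  "gauss_const c = K * Gamma (\<alpha> + 1) / c powr (\<alpha> + 1)"

lemma gauss_const_pos: "c > 0 \<Longrightarrow> gauss_const c > 0"
  using K_pos alpha_ge by (auto simp: gauss_const_def intro!: divide_pos_pos mult_pos_pos Gamma_real_pos)

lemma even_coeff_gauss:
  assumes c: "c > 0"
  shows "even_coeff (gauss c) m = of_real (gauss_const c * ((- ((real n)\<^sup>2 / (4 * c))) ^ m / fact m))"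
proof -
  have G: "Gamma (\<alpha> + 1) > 0" using alpha_ge by (intro Gamma_real_pos) auto
  have "\<alpha> + 1 \<notin> \<int>\<^sub>\<le>\<^sub>0" using alpha_ge by (auto elim!: nonpos_Ints_cases)
  then have Gm: "Gamma (\<alpha> + 1 + m) = Gamma (\<alpha> + 1) * pochhammer (\<alpha> + 1) m"
    using G by (simp add: pochhammer_Gamma)
  have cm: "c powr (\<alpha> + 1 + m) = c powr (\<alpha> + 1) * c ^ m"
    using c by (simp only: powr_add powr_realpow)
  have p: "pochhammer (\<alpha> + 1) m > 0" using alpha_ge by (intro pochhammer_pos) auto
  have "(LINT x|\<mu>. gauss c x * of_real (u x ^ m)) = of_real (LINT x|\<mu>. exp (- c * u x) * u x ^ m)"
    unfolding gauss_def of_real_mult[symmetric] by (rule integral_complex_of_real)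
  also have "\<dots> = of_real (gauss_const c * pochhammer (\<alpha> + 1) m / c ^ m)"
    unfolding exp_moment_mu[OF c] Gm cm gauss_const_def by simp
  finally have "even_coeff (gauss c) m = of_real (bcoef \<alpha> m * (gauss_const c * pochhammer (\<alpha> + 1) m / c ^ m))"
    by (simp add: even_coeff_def)
  also have "bcoef \<alpha> m * (gauss_const c * pochhammer (\<alpha> + 1) m / c ^ m)
      = gauss_const c * ((-1) ^ m * (real n / 2) ^ (2 * m) / c ^ m / fact m)"
    unfolding bcoef_def using p by (simp add: mult_ac)
  also have "(-1) ^ m * (real n / 2) ^ (2 * m) / c ^ m = (- ((real n)\<^sup>2 / (4 * c))) ^ m"
    unfolding power_mult power_mult_distrib[symmetric] power_divide[symmetric]
    by (simp add: power_divide)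
  finally show ?thesis .
qed

lemma odd_coeff_gauss: "odd_coeff (gauss c) m = 0"
proof -
  have "(LINT x|\<mu>. (of_real x * gauss c x) * of_real (u x ^ m)) =
      (LINT x|\<mu>. (of_real (-x) * gauss c (-x)) * of_real (u (-x) ^ m))"
    by (rule integral_mu_reflect[symmetric]) measurable
  also have "\<dots> = - (LINT x|\<mu>. (of_real x * gauss c x) * of_real (u x ^ m))"
    by (simp add: gauss_def)
  finally show ?thesis by (simp add: odd_coeff_def)
qed

text \<open>The moments of \<open>gauss c\<close> cancel the Pochhammer symbols of the kernel and
  leave an exponential series. The two rates have product \<open>n\<^sup>2 / 4\<close>, the origin
  of the threshold for \<open>a * b\<close>.\<close>

lemma F_kn_gauss:
  assumes c: "c > 0"
  shows "F_kn k n (gauss c) l = of_real (gauss_const c) * of_real (exp (- ((real n)\<^sup>2 / (4 * c)) * u l))"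
proof -
  have summand: "even_coeff (gauss c) m * of_real (u l) ^ m =
      of_real (gauss_const c * ((- ((real n)\<^sup>2 / (4 * c)) * u l) ^ m / fact m))" for m
    unfolding even_coeff_gauss[OF c] of_real_power[symmetric] of_real_mult[symmetric] power_mult_distrib
    by (rule arg_cong[where f = of_real]) simp
  obtain A where "F_kn k n (gauss c) l = (\<Sum>m. even_coeff (gauss c) m * of_real (u l) ^ m)
          + odd_factor * of_real l * (\<Sum>m. odd_coeff (gauss c) m * of_real (u l) ^ m)"
    using F_kn_expansion[OF measurable_gauss c dominated_gauss] by metis
  then have "F_kn k n (gauss c) l = (\<Sum>m. of_real (gauss_const c * ((- ((real n)\<^sup>2 / (4 * c)) * u l) ^ m / fact m)))"
    by (simp add: odd_coeff_gauss summand)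
  moreover have "(\<lambda>m. complex_of_real (gauss_const c * ((- ((real n)\<^sup>2 / (4 * c)) * u l) ^ m / fact m)))
      sums of_real (gauss_const c * exp (- ((real n)\<^sup>2 / (4 * c)) * u l))"
    by (intro sums_of_real sums_mult exp_sums)
  ultimately show ?thesis by (simp add: sums_iff)
qed

subsection \<open>Uniqueness\<close>

text \<open>A function whose integrals over the fibres of \<open>u\<close> vanish has vanishing even part, since
  the even part is itself a function of \<open>u\<close>.\<close>

lemma even_part_zero:
  fixes G :: "real \<Rightarrow> real"
  assumes [measurable]: "G \<in> borel_measurable borel" and int: "integrable \<mu> G"
    and zero: "\<And>A. A \<in> sets borel \<Longrightarrow> (LINT x|\<mu>. G x * indicator A (u x)) = 0"
  shows "AE x in \<mu>. G x + G (- x) = 0"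
proof -
  define E where "E = (\<lambda>x. G x + G (- x))"
  have [measurable]: "E \<in> borel_measurable borel" unfolding E_def by measurable
  have E_abs: "E (u x powr (real n / 2)) = E x" for x
    unfolding abs_eq_u_powr[symmetric] by (cases "x \<ge> 0") (auto simp: E_def)
  have int': "integrable \<mu> (\<lambda>x. G (- x))" using int by (subst integrable_mu_reflect) auto
  have E_int: "integrable \<mu> E" unfolding E_def using int int' by auto
  have half: "AE x in \<mu>. max 0 (s * E x) = 0" for s
  proof -
    \<comment> \<open>\<open>E x\<close> depends only on \<open>u x\<close>, so the set where
      \<open>s * E\<close> is positive is the preimage of \<open>A\<close> under \<open>u\<close>,
      and \<open>zero\<close> may be tested on it. The signs 1 and -1 of \<open>s\<close> together
      give \<open>E = 0\<close>.\<close>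
    define A where "A = {y. s * E (y powr (real n / 2)) > 0}"
    have [measurable]: "A \<in> sets borel" unfolding A_def by measurable
    have ind: "indicator A (u x) = (if s * E x > 0 then 1 else 0 :: real)" for x
      by (auto simp: A_def E_abs indicator_def)
    have i1: "integrable \<mu> (\<lambda>x. G x * indicator A (u x))"
      by (rule Bochner_Integration.integrable_bound[OF int]) (auto simp: indicator_def)
    then have i2: "integrable \<mu> (\<lambda>x. G (- x) * indicator A (u (- x)))"
      by (subst integrable_mu_reflect) auto
    have "(LINT x|\<mu>. G (- x) * indicator A (u (- x))) = (LINT x|\<mu>. G x * indicator A (u x))"
      by (rule integral_mu_reflect) measurable
    then have "(LINT x|\<mu>. G x * indicator A (u x) + G (- x) * indicator A (u (- x))) = 0"
      using i1 i2 zero[of A] by simp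
    moreover have "G x * indicator A (u x) + G (- x) * indicator A (u (- x)) = E x * indicator A (u x)" for x
      by (simp add: E_def algebra_simps)
    ultimately have "(LINT x|\<mu>. s * (E x * indicator A (u x))) = 0" by simp
    moreover have "s * (E x * indicator A (u x)) = max 0 (s * E x)" for x
      by (auto simp: ind max_def)
    ultimately have "(LINT x|\<mu>. max 0 (s * E x)) = 0" by simp
    moreover have "integrable \<mu> (\<lambda>x. max 0 (s * E x))" using E_int by auto
    ultimately show ?thesis by (subst (asm) integral_nonneg_eq_0_iff_AE) auto
  qed
  show ?thesis using half[of 1] half[of "-1"]
  proof eventually_elim
    case (elim x)
    then show ?case by (auto simp: E_def max_def split: if_splits)
  qed
qed

text \<open>\<open>even_part_zero\<close> applied to \<open>F\<close> and to \<open>x * F\<close>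
  yields \<open>F x + F (- x) = 0\<close> and \<open>x * F x - x * F (- x) = 0\<close>;
  \<open>x\<close> times the first plus the second is \<open>2 * x * F x = 0\<close>.\<close>

lemma real_zero_coeffs_imp_AE_zero:
  fixes F :: "real \<Rightarrow> real"
  assumes [measurable]: "F \<in> borel_measurable borel" and c: "c > 0"
    and int: "integrable \<mu> (\<lambda>x. F x * exp (c * u x))"
    and even: "\<And>m. (LINT x|\<mu>. F x * u x ^ m) = 0"
    and odd: "\<And>m. (LINT x|\<mu>. (x * F x) * u x ^ m) = 0"
  shows "AE x in \<mu>. F x = 0"
proof -
  have i: "integrable \<mu> (\<lambda>x. \<bar>F x\<bar> * u x ^ m * exp (d * u x))" if "d < c" for m d
    using that by (intro power_exp_integrable[OF _ _ _ _ int]) auto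
  have int_odd: "integrable \<mu> (\<lambda>x. (x * F x) * exp (d * u x))" if d: "d < c" for d
  proof (rule Bochner_Integration.integrable_bound)
    show "integrable \<mu> (\<lambda>x. \<bar>F x\<bar> * u x ^ 0 * exp (d * u x) + \<bar>F x\<bar> * u x ^ n * exp (d * u x))"
      using i[OF d] by (intro Bochner_Integration.integrable_add)
    show "AE x in \<mu>. norm ((x * F x) * exp (d * u x)) \<le> norm (\<bar>F x\<bar> * u x ^ 0 * exp (d * u x) + \<bar>F x\<bar> * u x ^ n * exp (d * u x))"
    proof (intro AE_I2)
      fix x
      have "\<bar>x\<bar> * (\<bar>F x\<bar> * exp (d * u x)) \<le> (1 + u x ^ n) * (\<bar>F x\<bar> * exp (d * u x))"
        by (intro mult_right_mono abs_le_Suc_u_power) auto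
      also have "\<dots> = \<bar>F x\<bar> * u x ^ 0 * exp (d * u x) + \<bar>F x\<bar> * u x ^ n * exp (d * u x)"
        by (simp add: algebra_simps)
      finally show "norm ((x * F x) * exp (d * u x)) \<le> norm (\<bar>F x\<bar> * u x ^ 0 * exp (d * u x) + \<bar>F x\<bar> * u x ^ n * exp (d * u x))"
        by (simp add: abs_mult mult.assoc)
    qed
  qed measurable
  have "AE x in \<mu>. F x + F (- x) = 0"
    using i[of 0 0] c
    by (intro even_part_zero zero_moments_imp_zero_integral_vimage[OF _ _ _ c int even])
       (auto simp: integrable_abs_iff)
  moreover have "AE x in \<mu>. x * F x + (- x) * F (- x) = 0"
    using int_odd[of 0] int_odd[of "c/2"] c
    by (intro even_part_zero zero_moments_imp_zero_integral_vimage[where c = "c/2", OF _ _ _ _ _ odd]) auto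
  moreover have "AE x in \<mu>. x \<noteq> 0"
    unfolding mu_eq using AE_lborel_singleton[of 0] by (subst AE_density) auto
  ultimately show ?thesis
  proof eventually_elim
    case (elim x)
    then have "x * (2 * F x) = 0" by (simp add: algebra_simps eq_neg_iff_add_eq_0)
    then show ?case using elim by simp
  qed
qed

lemma zero_coeffs_imp_AE_zero:
  fixes f :: "real \<Rightarrow> complex"
  assumes [measurable]: "f \<in> borel_measurable borel" and c: "c > 0"
    and dom: "dominated (\<lambda>x. of_real (exp (c * u x)) * f x)"
    and even: "\<And>m. even_coeff f m = 0" and odd: "\<And>m. odd_coeff f m = 0"
  shows "AE x in \<mu>. f x = 0"
proof -
  obtain D V where D: "D \<ge> 0" and V: "integrable \<mu> V" "\<And>x. V x \<ge> 0"
    and le: "AE x in \<mu>. norm (of_real (exp (c * u x)) * f x) \<le> D + V x"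
    using dom unfolding dominated_def by auto
  \<comment> \<open>Half of the decay is kept to integrate the constant \<open>D\<close> against the
    infinite measure.\<close>
  have int: "integrable \<mu> (\<lambda>x. norm (f x) * exp (c / 2 * u x))"
  proof (rule Bochner_Integration.integrable_bound)
    show "integrable \<mu> (\<lambda>x. D * (exp (- (c/2) * u x) * u x ^ 0) + V x)"
      using exp_moment_mu(1)[of "c/2" 0] c V by auto
    show "AE x in \<mu>. norm (norm (f x) * exp (c / 2 * u x)) \<le> norm (D * (exp (- (c/2) * u x) * u x ^ 0) + V x)"
      using le
    proof eventually_elim
      case (elim x)
      have "norm (f x) * exp (c / 2 * u x) = norm (of_real (exp (c * u x)) * f x) * exp (- (c/2) * u x)"
        by (simp add: norm_mult algebra_simps flip: exp_add)
      also have "\<dots> \<le> (D + V x) * exp (- (c/2) * u x)" using elim by (intro mult_right_mono) auto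
      also have "\<dots> = D * exp (- (c/2) * u x) + V x * exp (- (c/2) * u x)" by (simp add: algebra_simps)
      also have "\<dots> \<le> D * exp (- (c/2) * u x) + V x * 1"
        using c V by (intro add_left_mono mult_left_mono) auto
      finally show ?case using D V(2)[of x] by simp
    qed
  qed measurable
  have a: "\<alpha> \<ge> -1/2" "\<alpha> + n \<ge> -1/2" using alpha_ge by auto
  have e: "(LINT x|\<mu>. f x * of_real (u x ^ m)) = 0" for m
    using even[of m] bcoef_nonzero[OF a(1)] by (simp add: even_coeff_def)
  have o: "(LINT x|\<mu>. (of_real x * f x) * of_real (u x ^ m)) = 0" for m
    using odd[of m] bcoef_nonzero[OF a(2)] by (simp add: odd_coeff_def)
  note i1 = dominated_coeff_integrable(1)[OF assms(1) c dom]
  note i2 = dominated_coeff_integrable(2)[OF assms(1) c dom]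
  have c2: "c / 2 > 0" using c by simp
  have "AE x in \<mu>. Re (f x) = 0"
  proof (rule real_zero_coeffs_imp_AE_zero[OF _ c2])
    show "integrable \<mu> (\<lambda>x. Re (f x) * exp (c / 2 * u x))"
      by (rule Bochner_Integration.integrable_bound[OF int]) (auto simp: abs_mult abs_Re_le_cmod)
    show "(LINT x|\<mu>. Re (f x) * u x ^ m) = 0" for m
      using integral_Re[OF i1[of m]] e[of m] by simp
    show "(LINT x|\<mu>. (x * Re (f x)) * u x ^ m) = 0" for m
      using integral_Re[OF i2[of m]] o[of m] by simp
  qed measurable
  moreover have "AE x in \<mu>. Im (f x) = 0"
  proof (rule real_zero_coeffs_imp_AE_zero[OF _ c2])
    show "integrable \<mu> (\<lambda>x. Im (f x) * exp (c / 2 * u x))"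
      by (rule Bochner_Integration.integrable_bound[OF int]) (auto simp: abs_mult abs_Im_le_cmod)
    show "(LINT x|\<mu>. Im (f x) * u x ^ m) = 0" for m
      using integral_Im[OF i1[of m]] e[of m] by simp
    show "(LINT x|\<mu>. (x * Im (f x)) * u x ^ m) = 0" for m
      using integral_Im[OF i2[of m]] o[of m] by simp
  qed measurable
  ultimately show ?thesis by eventually_elim (simp add: complex_eq_iff)
qed

end

subsection \<open>Proof of the theorem\<close>

lemma powser_zero_imp_coeff_zero:
  fixes a :: "nat \<Rightarrow> complex"
  assumes "\<And>w. (\<lambda>m. a m * w ^ m) sums 0"
  shows "a m = 0"
proof (cases "m = 0")
  case True
  then show ?thesis using sums_unique2[OF powser_sums_zero[of a] assms[of 0]] by simp
next
  case False
  show ?thesis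
  proof (rule ccontr)
    assume "a m \<noteq> 0"
    then show False
    proof (rule powser_0_nonzero[of 1 0 a "\<lambda>_. 0" m, rotated 3])
      fix s :: real assume "0 < s" "\<And>z. z \<in> cball 0 s - {0::complex} \<Longrightarrow> (0::complex) \<noteq> 0"
      then show False by (metis DiffI mem_cball_0 norm_of_real abs_of_pos order_refl of_real_eq_0_iff
            less_irrefl singletonD)
    qed (use assms False in auto)
  qed
qed

text \<open>Multiplication by \<open>exp (\<sigma> m * y)\<close> makes every term but the slowest,
  which is the last, tend to 0. The limit is the last coefficient, so zeros at arbitrarily large
  \<open>y\<close> force it to be 0.\<close>

lemma exp_sum_independent:
  fixes \<sigma> :: "nat \<Rightarrow> real" and c :: "nat \<Rightarrow> complex"
  assumes dec: "\<And>i j. i < j \<Longrightarrow> \<sigma> j < \<sigma> i"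
    and "frequently (\<lambda>y. (\<Sum>i<m. c i * of_real (exp (- \<sigma> i * y))) = 0) at_top" and "i < m"
  shows "c i = 0"
  using assms(2,3)
proof (induction m)
  case (Suc m)
  have term_lim: "((\<lambda>y. c i * of_real (exp (- (\<sigma> i - \<sigma> m) * y))) \<longlongrightarrow> 0) at_top" if "i < m" for i
  proof -
    have "\<sigma> i - \<sigma> m > 0" using dec[OF that] by simp
    then have "((\<lambda>y. exp (- (\<sigma> i - \<sigma> m) * y)) \<longlongrightarrow> 0) at_top" by real_asymp
    then have "((\<lambda>y. c i * of_real (exp (- (\<sigma> i - \<sigma> m) * y))) \<longlongrightarrow> c i * of_real 0) at_top"
      by (intro tendsto_intros)
    then show ?thesis by simp
  qed
  have "((\<lambda>y. (\<Sum>i<m. c i * of_real (exp (- (\<sigma> i - \<sigma> m) * y))) + c m) \<longlongrightarrow> (\<Sum>i<m. 0) + c m) at_top"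
    by (intro tendsto_add tendsto_sum term_lim tendsto_const) auto
  then have lim: "((\<lambda>y. (\<Sum>i<m. c i * of_real (exp (- (\<sigma> i - \<sigma> m) * y))) + c m) \<longlongrightarrow> c m) at_top" by simp
  have "frequently (\<lambda>y. (\<Sum>i<m. c i * of_real (exp (- (\<sigma> i - \<sigma> m) * y))) + c m = 0) at_top"
    using Suc.prems(1)
  proof (rule frequently_elim1)
    fix y assume *: "(\<Sum>i<Suc m. c i * of_real (exp (- \<sigma> i * y))) = 0"
    have "(\<Sum>i<m. c i * of_real (exp (- (\<sigma> i - \<sigma> m) * y))) + c m
        = of_real (exp (\<sigma> m * y)) * (\<Sum>i<Suc m. c i * of_real (exp (- \<sigma> i * y)))"
      by (simp add: distrib_left sum_distrib_left mult.left_commute flip: exp_add of_real_mult)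
        (simp add: algebra_simps)
    then show "(\<Sum>i<m. c i * of_real (exp (- (\<sigma> i - \<sigma> m) * y))) + c m = 0" using * by simp
  qed
  then have cm: "c m = 0"
    using tendsto_imp_eventually_ne[OF lim, of 0] by (auto simp: frequently_def)
  show ?case
  proof (cases "i = m")
    case False
    then show ?thesis using Suc.IH Suc.prems cm by simp
  qed (use cm in simp)
qed simp

context kn_weight
begin

text \<open>The values of \<open>E\<close> on the positive axis are only controlled in the mean, so the
  Phragmen-Lindelof principle is applied to a primitive of \<open>E\<close>.\<close>

lemma entire_dominated_imp_poly:
  fixes E :: "complex \<Rightarrow> complex"
  assumes B: "B \<ge> 0" and C: "C \<ge> 0" and hol: "E holomorphic_on UNIV"
    and growth: "\<And>w. norm (E w) \<le> C * (1 + norm w) * exp (B * (norm w + Re w))"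
    and D: "D \<ge> 0" and V: "integrable \<mu> V" "\<And>x. V x \<ge> 0"
    and dom: "AE x in \<mu>. 1 \<le> u x \<longrightarrow> norm (E (of_real (u x))) \<le> D + V x"
  shows "\<exists>P. \<forall>w. E w = poly P w"
proof -
  obtain G where G: "\<And>w. (G has_field_derivative E w) (at w)"
    using holomorphic_convex_primitive'[of UNIV E] hol by auto
  define E1 where "E1 = (\<lambda>w. G w - G 0)"
  have E1_deriv: "(E1 has_field_derivative E w) (at w)" for w
    unfolding E1_def using G by (auto intro!: derivative_eq_intros)
  have E1_hol: "E1 holomorphic_on UNIV"
    using E1_deriv by (auto simp: holomorphic_on_def field_differentiable_def intro: has_field_derivative_at_within)
  \<comment> \<open>On the segment from 0 to \<open>w\<close> the weight
    \<open>norm z + Re z\<close> is \<open>t\<close> times its nonnegative value at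
    \<open>w\<close>, so integrating \<open>E\<close> only costs a factor
    \<open>norm w\<close>.\<close>
  have E1_growth: "norm (E1 w) \<le> C * (1 + norm w) ^ 2 * exp (B * (norm w + Re w))" for w
  proof -
    have "norm (E1 w - E1 0) \<le> (C * (1 + norm w) * exp (B * (norm w + Re w))) * norm (w - 0)"
    proof (rule field_differentiable_bound[where S = "closed_segment 0 w"])
      fix z assume "z \<in> closed_segment 0 w"
      then obtain t where t: "0 \<le> t" "t \<le> 1" "z = of_real t * w"
        by (auto simp: closed_segment_def scaleR_conv_of_real)
      have "norm w + Re w \<ge> 0" using abs_Re_le_cmod[of w] by linarith
      then have "t * (norm w + Re w) \<le> 1 * (norm w + Re w)" using t by (intro mult_right_mono) auto
      then have "norm z + Re z \<le> norm w + Re w" using t by (simp add: norm_mult algebra_simps)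
      moreover have "norm z \<le> norm w" using t by (simp add: norm_mult mult_left_le_one_le)
      ultimately have "C * (1 + norm z) * exp (B * (norm z + Re z)) \<le> C * (1 + norm w) * exp (B * (norm w + Re w))"
        using B C by (intro mult_mono mult_left_mono) (auto intro: mult_left_mono)
      then show "norm (E z) \<le> C * (1 + norm w) * exp (B * (norm w + Re w))"
        using growth[of z] by linarith
      show "(E1 has_field_derivative E z) (at z within closed_segment 0 w)"
        using E1_deriv by (rule has_field_derivative_at_within)
    qed auto
    also have "\<dots> \<le> (C * (1 + norm w) * exp (B * (norm w + Re w))) * (1 + norm w)"
      using C by (intro mult_left_mono) auto
    finally show ?thesis by (simp add: E1_def power2_eq_square mult_ac)
  qed
  define N where "N = nat \<lceil>\<alpha> + 1\<rceil>"
  define C1 where "C1 = D / (\<alpha> + 1) + (LINT x|\<mu>. V x) / K"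
  have a1: "\<alpha> + 1 > 0" using alpha_ge by simp
  have V0: "(LINT x|\<mu>. V x) \<ge> 0" using V by (intro integral_nonneg_AE) auto
  have C1: "C1 \<ge> 0" using D V0 a1 K_pos by (simp add: C1_def)
  have contE: "continuous_on S (\<lambda>y. E (of_real y))" for S :: "real set"
    by (intro continuous_on_compose2[OF holomorphic_on_imp_continuous_on[OF hol]] continuous_intros) auto
  have [measurable]: "(\<lambda>y. E (of_real y)) \<in> borel_measurable borel"
    by (intro borel_measurable_continuous_onI contE)
  \<comment> \<open>On \<open>{1..x}\<close> Lebesgue measure is at most \<open>x / K\<close> times
    the image of \<mu> under \<open>u\<close>, since \<open>1 \<le> y * y powr \<alpha>\<close>
    there; then \<open>D + V\<close> is integrated over \<open>u t \<le> x\<close>. The starting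
    point 1 matches \<open>dom\<close>.\<close>
  have mean: "integral {1..x} (\<lambda>y. norm (E (of_real y))) \<le> C1 * x ^ (N + 1)" if x: "x \<ge> 1" for x
  proof -
    define I where "I = integral {1..x} (\<lambda>y. norm (E (of_real y)))"
    have "((\<lambda>y. norm (E (of_real y))) has_integral I) {1..x}"
      unfolding I_def by (intro integrable_integral integrable_continuous_interval continuous_intros contE)
    then have "((\<lambda>y. norm (E (of_real y)) * indicator {1..x} y) has_integral I) UNIV"
      by (subst (asm) has_integral_restrict_UNIV[symmetric]) (auto elim!: has_integral_eq[rotated] simp: indicator_def)
    then have "ennreal I = (\<integral>\<^sup>+ y. ennreal (norm (E (of_real y)) * indicator {1..x} y) \<partial>lborel)"
      by (intro nn_integral_has_integral_lborel[symmetric]) auto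
    also have "\<dots> \<le> (\<integral>\<^sup>+ y. ennreal (x / K) * (ennreal (K * y powr \<alpha> * indicator {0..} y) *
        ennreal (norm (E (of_real y)) * indicator {1..x} y)) \<partial>lborel)"
    proof (intro nn_integral_mono)
      fix y :: real
      show "ennreal (norm (E (of_real y)) * indicator {1..x} y) \<le> ennreal (x / K) *
          (ennreal (K * y powr \<alpha> * indicator {0..} y) * ennreal (norm (E (of_real y)) * indicator {1..x} y))"
      proof (cases "y \<in> {1..x}")
        case True
        have "y powr (-1) \<le> y powr \<alpha>" using True alpha_ge by (intro powr_mono) auto
        then have "1 \<le> y * y powr \<alpha>" using True by (simp add: powr_minus field_simps)
        also have "\<dots> \<le> x * y powr \<alpha>" using True by (intro mult_right_mono) auto
        finally have "1 * norm (E (of_real y)) \<le> (x * y powr \<alpha>) * norm (E (of_real y))"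
          by (intro mult_right_mono) auto
        also have "\<dots> = x / K * (K * y powr \<alpha> * norm (E (of_real y)))" using K_pos by simp
        finally have "ennreal (norm (E (of_real y))) \<le> ennreal (x / K * (K * y powr \<alpha> * norm (E (of_real y))))"
          by (intro ennreal_leI) simp
        also have "\<dots> = ennreal (x / K) * (ennreal (K * y powr \<alpha>) * ennreal (norm (E (of_real y))))"
          using K_pos x by (simp only: ennreal_mult ennreal_mult' divide_nonneg_pos mult_nonneg_nonneg less_imp_le powr_ge_zero norm_ge_zero)
        finally show ?thesis using True by simp
      qed auto
    qed
    also have "\<dots> = ennreal (x / K) * (\<integral>\<^sup>+ y. ennreal (K * y powr \<alpha> * indicator {0..} y) *
        ennreal (norm (E (of_real y)) * indicator {1..x} y) \<partial>lborel)"
      by (rule nn_integral_cmult) measurable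
    also have "(\<integral>\<^sup>+ y. ennreal (K * y powr \<alpha> * indicator {0..} y) * ennreal (norm (E (of_real y)) * indicator {1..x} y) \<partial>lborel)
        = (\<integral>\<^sup>+ t. ennreal (norm (E (of_real (u t))) * indicator {1..x} (u t)) \<partial>\<mu>)"
      by (rule nn_integral_mu_u[symmetric]) measurable
    also have "\<dots> \<le> (\<integral>\<^sup>+ t. ennreal D * indicator {t. u t \<le> x} t + ennreal (V t) \<partial>\<mu>)"
    proof (rule nn_integral_mono_AE)
      show "AE t in \<mu>. ennreal (norm (E (of_real (u t))) * indicator {1..x} (u t))
          \<le> ennreal D * indicator {t. u t \<le> x} t + ennreal (V t)"
        using dom
      proof eventually_elim
        case (elim t)
        show ?case
        proof (cases "u t \<in> {1..x}")
          case True
          then have "ennreal (norm (E (of_real (u t)))) \<le> ennreal (D + V t)"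
            using elim by (intro ennreal_leI) auto
          then show ?thesis using True D V(2)[of t] by (simp add: ennreal_plus)
        qed auto
      qed
    qed
    also have "\<dots> = ennreal D * emeasure \<mu> {t. u t \<le> x} + (\<integral>\<^sup>+ t. ennreal (V t) \<partial>\<mu>)"
      using V by (subst nn_integral_add) (auto simp: nn_integral_cmult_indicator)
    also have "(\<integral>\<^sup>+ t. ennreal (V t) \<partial>\<mu>) = ennreal (LINT t|\<mu>. V t)"
      using V by (intro nn_integral_eq_integral) auto
    also have "ennreal (x / K) * (ennreal D * emeasure \<mu> {t. u t \<le> x} + ennreal (LINT t|\<mu>. V t))
        = ennreal (x / K * (D * (K * x powr (\<alpha> + 1) / (\<alpha> + 1)) + (LINT t|\<mu>. V t)))"
      using x D V0 K_pos a1 by (simp add: emeasure_mu_u_le ennreal_mult'[symmetric] ennreal_plus[symmetric] del: ennreal_plus)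
    finally have "ennreal I \<le> ennreal (x / K * (D * (K * x powr (\<alpha> + 1) / (\<alpha> + 1)) + (LINT t|\<mu>. V t)))"
      by (simp add: mult_left_mono)
    then have "I \<le> x / K * (D * (K * x powr (\<alpha> + 1) / (\<alpha> + 1)) + (LINT t|\<mu>. V t))"
      using x D V0 K_pos a1 by (subst (asm) ennreal_le_iff) auto
    also have "\<dots> = x * (D / (\<alpha> + 1) * x powr (\<alpha> + 1) + (LINT t|\<mu>. V t) / K * 1)"
      using K_pos by (simp add: field_simps)
    also have "\<dots> \<le> x * (D / (\<alpha> + 1) * x ^ N + (LINT t|\<mu>. V t) / K * x ^ N)"
    proof (intro mult_left_mono add_mono)
      have "\<alpha> + 1 \<le> real N" unfolding N_def by linarith
      then have "x powr (\<alpha> + 1) \<le> x powr real N" using x by (intro powr_mono) auto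
      then show "x powr (\<alpha> + 1) \<le> x ^ N" using x by (simp add: powr_realpow)
      show "1 \<le> x ^ N" using x by (rule one_le_power)
    qed (use x D a1 V0 K_pos in auto)
    also have "\<dots> = C1 * x ^ (N + 1)" by (simp add: C1_def algebra_simps)
    finally show ?thesis by (simp add: I_def)
  qed
  \<comment> \<open>Collects the bound on \<open>{0..1}\<close> and the mean bound beyond 1; the
    summand 1 ensures positivity.\<close>
  define C2 where "C2 = 4 * C * exp (2 * B) + C1 + 1"
  have C2: "C2 > 0" using C C1 by (simp add: C2_def add_nonneg_pos)
  have small: "norm (E1 (of_real x)) \<le> 4 * C * exp (2 * B)" if "0 \<le> x" "x \<le> 1" for x
  proof -
    have "norm (E1 (of_real x)) \<le> C * (1 + x) ^ 2 * exp (B * (x + x))" using E1_growth[of "of_real x"] that by simp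
    also have "\<dots> \<le> C * 2 ^ 2 * exp (B * 2)"
      using that B C by (intro mult_mono power_mono mult_left_mono) (auto intro: mult_left_le)
    finally show ?thesis by (simp add: mult_ac)
  qed
  have axis: "norm (E1 (of_real x)) \<le> C2 * (1 + x) ^ (N + 2)" if x: "x \<ge> 0" for x
  proof -
    have *: "norm (E1 (of_real x)) \<le> 4 * C * exp (2 * B) + C1 * (1 + x) ^ (N + 2)"
    proof (cases "x \<le> 1")
      case True
      then show ?thesis using small[OF x True] C1 x by (simp add: add_increasing2)
    next
      case False
      have "((\<lambda>y. E (of_real y)) has_integral (E1 (of_real x) - E1 (of_real 1))) {1..x}"
        using False E1_deriv
        by (intro fundamental_theorem_of_calculus has_vector_derivative_real_field) auto
      then have eq: "E1 (of_real x) - E1 (of_real 1) = integral {1..x} (\<lambda>y. E (of_real y))"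
        by (simp add: integral_unique)
      have "norm (E1 (of_real x) - E1 (of_real 1)) \<le> integral {1..x} (\<lambda>y. norm (E (of_real y)))"
        unfolding eq by (intro Henstock_Kurzweil_Integration.integral_norm_bound_integral
            integrable_continuous_interval continuous_intros contE) auto
      also have "\<dots> \<le> C1 * x ^ (N + 1)" using mean False by simp
      also have "\<dots> \<le> C1 * (1 + x) ^ (N + 2)"
      proof (intro mult_left_mono C1)
        have "x ^ (N + 1) \<le> (1 + x) ^ (N + 1)" using x by (intro power_mono) auto
        also have "\<dots> \<le> (1 + x) ^ (N + 2)" using x by (intro power_increasing) auto
        finally show "x ^ (N + 1) \<le> (1 + x) ^ (N + 2)" .
      qed
      finally show ?thesis
        using small[of 1] norm_triangle_ineq[of "E1 (of_real x) - E1 (of_real 1)" "E1 (of_real 1)"] by simp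
    qed
    have ge1: "1 \<le> (1 + x) ^ (N + 2)" using x by (intro one_le_power) auto
    then have "4 * C * exp (2 * B) * 1 \<le> 4 * C * exp (2 * B) * (1 + x) ^ (N + 2)"
      using C by (intro mult_left_mono) auto
    with * ge1 show ?thesis unfolding C2_def distrib_right by linarith
  qed
  have "\<exists>P. \<forall>w. E1 w = poly P w"
  proof (rule entire_polynomial_growth[OF B C2 E1_hol _ axis])
    fix w :: complex
    have "C \<le> 4 * C * exp (2 * B)" using C B mult_mono[of 1 4 1 "exp (2 * B)"] mult_left_mono[of 1 "4 * exp (2 * B)" C] by simp
    then have "C \<le> C2" using C1 by (simp add: C2_def)
    moreover have "(1 + norm w) ^ 2 \<le> (1 + norm w) ^ (N + 2)" by (intro power_increasing) auto
    ultimately have "C * (1 + norm w) ^ 2 * exp (B * (norm w + Re w)) \<le> C2 * (1 + norm w) ^ (N + 2) * exp (B * (norm w + Re w))"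
      using C C2 by (intro mult_right_mono mult_mono) auto
    then show "norm (E1 w) \<le> C2 * (1 + norm w) ^ (N + 2) * exp (B * (norm w + Re w))"
      using E1_growth[of w] by linarith
  qed
  then obtain P where "E1 = poly P" by auto
  then have "E w = poly (pderiv P) w" for w
    using DERIV_unique[OF E1_deriv[of w]] poly_DERIV[of P w] by simp
  then show ?thesis by blast
qed


section \<open>The extremal case: only Gaussians remain\<close>

lemma dominated_mono:
  assumes "dominated h" "\<And>x. norm (g x) \<le> norm (h x)"
  shows "dominated g"
proof -
  obtain D V where "D \<ge> 0" "integrable \<mu> V" "\<forall>x. V x \<ge> 0" "AE x in \<mu>. norm (h x) \<le> D + V x"
    using assms(1) unfolding dominated_def by auto
  moreover from this(4) have "AE x in \<mu>. norm (g x) \<le> D + V x"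
    by eventually_elim (rule order_trans[OF assms(2)])
  ultimately show ?thesis unfolding dominated_def by blast
qed

lemma dominated_diff:
  assumes "dominated g" "dominated h"
  shows "dominated (\<lambda>x. g x - c * h x)"
proof -
  obtain D V where 1: "D \<ge> 0" "integrable \<mu> V" "\<forall>x. V x \<ge> 0" "AE x in \<mu>. norm (g x) \<le> D + V x"
    using assms(1) unfolding dominated_def by auto
  obtain D' V' where 2: "D' \<ge> 0" "integrable \<mu> V'" "\<forall>x. V' x \<ge> 0" "AE x in \<mu>. norm (h x) \<le> D' + V' x"
    using assms(2) unfolding dominated_def by auto
  have "AE x in \<mu>. norm (g x - c * h x) \<le> (D + norm c * D') + (V x + norm c * V' x)"
    using 1(4) 2(4)
  proof eventually_elim
    case (elim x)
    have "norm (g x - c * h x) \<le> norm (g x) + norm c * norm (h x)"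
      using norm_triangle_ineq4[of "g x" "c * h x"] by (simp add: norm_mult)
    also have "\<dots> \<le> (D + V x) + norm c * (D' + V' x)" using elim by (intro add_mono mult_left_mono) auto
    finally show ?case by (simp add: algebra_simps)
  qed
  moreover have "integrable \<mu> (\<lambda>x. V x + norm c * V' x)" using 1 2 by auto
  ultimately show ?thesis unfolding dominated_def
    using 1 2 by (intro exI[of _ "D + norm c * D'"] exI[of _ "\<lambda>x. V x + norm c * V' x"]) auto
qed

lemma coeff_diff:
  assumes [measurable]: "f \<in> borel_measurable borel" "g \<in> borel_measurable borel" and c: "c > 0"
    and f: "dominated (\<lambda>x. of_real (exp (c * u x)) * f x)"
    and g: "dominated (\<lambda>x. of_real (exp (c * u x)) * g x)"
  shows "even_coeff (\<lambda>x. f x - s * g x) m = even_coeff f m - s * even_coeff g m"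
    and "odd_coeff (\<lambda>x. f x - s * g x) m = odd_coeff f m - s * odd_coeff g m"
proof -
  note int = dominated_coeff_integrable[OF _ c]
  have "(LINT x|\<mu>. (f x - s * g x) * of_real (u x ^ m)) =
      (LINT x|\<mu>. f x * of_real (u x ^ m) - s * (g x * of_real (u x ^ m)))"
    by (simp add: algebra_simps)
  also have "\<dots> = (LINT x|\<mu>. f x * of_real (u x ^ m)) - s * (LINT x|\<mu>. g x * of_real (u x ^ m))"
    using int(1)[OF assms(1) f, of m] int(1)[OF assms(2) g, of m] by simp
  finally show "even_coeff (\<lambda>x. f x - s * g x) m = even_coeff f m - s * even_coeff g m"
    unfolding even_coeff_def by (simp only: right_diff_distrib mult.left_commute)
  have "(LINT x|\<mu>. (of_real x * (f x - s * g x)) * of_real (u x ^ m)) =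
      (LINT x|\<mu>. of_real x * f x * of_real (u x ^ m) - s * (of_real x * g x * of_real (u x ^ m)))"
    by (simp add: algebra_simps)
  also have "\<dots> = (LINT x|\<mu>. of_real x * f x * of_real (u x ^ m)) - s * (LINT x|\<mu>. of_real x * g x * of_real (u x ^ m))"
    using int(2)[OF assms(1) f, of m] int(2)[OF assms(2) g, of m] by simp
  finally show "odd_coeff (\<lambda>x. f x - s * g x) m = odd_coeff f m - s * odd_coeff g m"
    unfolding odd_coeff_def by (simp only: right_diff_distrib mult.left_commute)
qed

text \<open>A nonconstant polynomial exceeds \<open>D + 1\<close> in norm far out, forcing
  \<open>V \<ge> 1\<close> on a tail.\<close>

lemma poly_dominated_imp_const:
  assumes V: "integrable \<mu> V" and dom: "AE x in \<mu>. norm (poly P (complex_of_real (u x))) \<le> D + V x"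
  shows "\<exists>a. P = [:a:]"
proof (cases P)
  case (pCons a p)
  have "p = 0"
  proof (rule ccontr)
    assume "p \<noteq> 0"
    then obtain r where r: "\<And>z. r \<le> norm z \<Longrightarrow> D + 1 \<le> norm (poly P z)"
      using poly_infinity[of p "D + 1" a] pCons by auto
    have "AE x in \<mu>. u x > r \<longrightarrow> 1 \<le> V x"
      using dom
    proof eventually_elim
      case (elim x)
      show ?case using elim r[of "of_real (u x)"] by auto
    qed
    then show False using integrable_imp_not_ge_1_tail[OF V] by blast
  qed
  then show ?thesis using pCons by simp
qed

text \<open>A nonzero polynomial stays away from 0 far out, and the factor
  \<open>\<bar>x\<bar>\<close> then exceeds every bound, so that nonzero constants are excluded as
  well.\<close>

lemma odd_poly_dominated_imp_zero:
  assumes V: "integrable \<mu> V" and dom: "AE x in \<mu>. \<bar>x\<bar> * norm (poly P (complex_of_real (u x))) \<le> D + V x"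
  shows "P = 0"
proof (rule ccontr)
  assume P: "P \<noteq> 0"
  obtain a p where pC: "P = pCons a p" by (cases P)
  obtain r d where d: "d > 0" and r: "\<And>y. r < y \<Longrightarrow> d \<le> norm (poly P (complex_of_real y))"
  proof (cases "p = 0")
    case True
    then show ?thesis using P pC by (intro that[of "norm a"]) auto
  next
    case False
    then obtain r where "\<And>z. r \<le> norm z \<Longrightarrow> 1 \<le> norm (poly P z)"
      using poly_infinity[of p 1 a] pC by auto
    then show ?thesis by (intro that[of 1 r]) auto
  qed
  define R where "R = max r (u ((\<bar>D\<bar> + 1) / d))"
  have "AE x in \<mu>. u x > R \<longrightarrow> 1 \<le> V x"
    using dom
  proof eventually_elim
    case (elim x)
    show ?case
    proof
      assume ux: "u x > R"
      then have "\<not> \<bar>x\<bar> \<le> u ((\<bar>D\<bar> + 1) / d) powr (real n / 2)"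
        using u_le_iff[of "u ((\<bar>D\<bar> + 1) / d)" x] by (simp add: R_def)
      then have "(\<bar>D\<bar> + 1) / d \<le> \<bar>x\<bar>" unfolding abs_eq_u_powr[symmetric] using d by simp
      then have "\<bar>D\<bar> + 1 \<le> \<bar>x\<bar> * d" using d by (simp add: field_simps)
      also have "\<dots> \<le> \<bar>x\<bar> * norm (poly P (complex_of_real (u x)))"
        using r[of "u x"] ux by (intro mult_left_mono) (auto simp: R_def)
      finally show "1 \<le> V x" using elim by linarith
    qed
  qed
  then show False using integrable_imp_not_ge_1_tail[OF V] by blast
qed

text \<open>The borderline case, in which both decay rates are those of one Gaussian. The transform
  is identified along with \<open>f\<close>, for use when only \<open>q\<close> is finite.\<close>

lemma hardy_gauss:
  fixes f :: "real \<Rightarrow> complex"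
  assumes [measurable]: "f \<in> borel_measurable borel" and c: "c > 0"
    and dom: "dominated (\<lambda>x. of_real (exp (c * u x)) * f x)"
    and domF: "dominated (\<lambda>l. of_real (exp ((real n)\<^sup>2 / (4 * c) * u l)) * F_kn k n f l)"
  obtains s where "AE x in \<mu>. f x = s * gauss c x"
    and "\<And>l. F_kn k n f l = s * of_real (gauss_const c) * gauss ((real n)\<^sup>2 / (4 * c)) l"
proof -
  define B where "B = (real n)\<^sup>2 / (4 * c)"
  have B: "B \<ge> 0" using c by (simp add: B_def)
  obtain A where A: "A \<ge> 0"
    and ev: "\<And>m. norm (even_coeff f m) \<le> A * ((real m + 1) * B ^ m / fact m)"
    and od: "\<And>m. norm (odd_coeff f m) \<le> A * ((real m + 1) * B ^ m / fact m)"
    and F: "\<And>l. F_kn k n f l = (\<Sum>m. even_coeff f m * of_real (u l) ^ m)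
          + odd_factor * of_real l * (\<Sum>m. odd_coeff f m * of_real (u l) ^ m)"
    using F_kn_expansion[OF assms(1) c dom, folded B_def] by blast
  \<comment> \<open>The exponential turns the growth \<open>exp (B * norm w)\<close> into
    \<open>exp (B * (norm w + Re w))\<close>, and at \<open>w = u l\<close> it is the weight of
    \<open>domF\<close>.\<close>
  define E where "E = (\<lambda>cf w. exp (of_real B * w) * (\<Sum>m. cf m * w ^ m) :: complex)"
  have E_hol: "E cf holomorphic_on UNIV" if "\<And>m. norm (cf m) \<le> A * ((real m + 1) * B ^ m / fact m)" for cf
    unfolding E_def by (intro holomorphic_intros exp_type_powser(2)[OF A B that])
  have E_growth: "norm (E cf w) \<le> A * (1 + B) * (1 + norm w) * exp (B * (norm w + Re w))"
    if "\<And>m. norm (cf m) \<le> A * ((real m + 1) * B ^ m / fact m)" for cf w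
  proof -
    have "norm (E cf w) \<le> exp (B * Re w) * (A * (1 + B * norm w) * exp (B * norm w))"
      unfolding E_def norm_mult using exp_type_powser(3)[OF A B that, of w] by (simp add: mult_left_mono)
    also have "\<dots> = A * (1 + B * norm w) * exp (B * (norm w + Re w))"
      by (simp add: distrib_left exp_add mult_ac)
    also have "\<dots> \<le> A * ((1 + B) * (1 + norm w)) * exp (B * (norm w + Re w))"
      using A B by (intro mult_right_mono mult_left_mono) (auto simp: algebra_simps)
    finally show ?thesis by (simp add: mult.assoc)
  qed
  let ?Ee = "E (even_coeff f)" and ?Eo = "E (odd_coeff f)"
  define h where "h = (\<lambda>l. of_real (exp (B * u l)) * F_kn k n f l)"
  have h: "h l = ?Ee (of_real (u l)) + odd_factor * of_real l * ?Eo (of_real (u l))" for l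
    by (simp add: h_def F E_def algebra_simps flip: exp_of_real)
  obtain D V where D: "D \<ge> 0" and V: "integrable \<mu> V" "\<forall>x. V x \<ge> 0" "AE x in \<mu>. norm (h x) \<le> D + V x"
    using domF unfolding dominated_def h_def B_def by auto
  \<comment> \<open>Adding the reflected \<open>V\<close> bounds \<open>h x\<close> and
    \<open>h (- x)\<close> together; their half sum and half difference are the even and the odd
    part of \<open>h\<close>.\<close>
  define W where "W = (\<lambda>x. V x + V (- x))"
  have Vm: "V \<in> borel_measurable borel" using V(1) borel_measurable_integrable by force
  have W: "integrable \<mu> W" "\<And>x. W x \<ge> 0"
    using V integrable_mu_reflect[OF Vm] by (auto simp: W_def)
  have both: "AE x in \<mu>. norm (?Ee (of_real (u x))) \<le> D + W x \<and>
      norm odd_factor * (\<bar>x\<bar> * norm (?Eo (of_real (u x)))) \<le> D + W x"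
    using V(3) AE_mu_reflect[OF V(3)]
  proof eventually_elim
    case (elim x)
    let ?a = "?Ee (of_real (u x))" and ?b = "odd_factor * of_real x * ?Eo (of_real (u x))"
    have hx: "h x = ?a + ?b" "h (- x) = ?a - ?b" using h[of x] h[of "- x"] by simp_all
    have "2 * norm ?a = norm (h x + h (- x))" unfolding hx by (simp flip: norm_mult)
    also have "\<dots> \<le> norm (h x) + norm (h (- x))" by (rule norm_triangle_ineq)
    finally have 1: "2 * norm ?a \<le> 2 * D + W x" using elim by (simp add: W_def)
    have "h x - h (- x) = 2 * ?b" unfolding hx by algebra
    then have "2 * norm ?b = norm (h x - h (- x))" by (simp only: norm_mult[of 2] norm_numeral)
    also have "\<dots> \<le> norm (h x) + norm (h (- x))" by (rule norm_triangle_ineq4)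
    finally have 2: "2 * norm ?b \<le> 2 * D + W x" using elim by (simp add: W_def)
    show ?case using 1 2 W(2)[of x] by (simp add: norm_mult mult.assoc)
  qed
  define q where "q = norm odd_factor"
  have q: "q > 0" using odd_factor_nonzero by (simp add: q_def)
  have odd: "AE x in \<mu>. \<bar>x\<bar> * norm (?Eo (of_real (u x))) \<le> D / q + W x / q"
    using both by eventually_elim (use q in \<open>simp add: q_def field_simps\<close>)
  have AB0: "A * (1 + B) \<ge> 0" using A B by simp
  have "\<exists>P. \<forall>w. ?Ee w = poly P w"
    by (rule entire_dominated_imp_poly[OF B AB0 E_hol[OF ev] E_growth[OF ev] D W])
       (use both in \<open>auto elim!: eventually_mono\<close>)
  then obtain P where P: "\<And>w. ?Ee w = poly P w" by blast
  have "AE x in \<mu>. norm (poly P (complex_of_real (u x))) \<le> D + W x"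
    using both by eventually_elim (simp add: P)
  then obtain a where a: "P = [:a:]" using poly_dominated_imp_const[OF W(1)] by blast
  have "\<exists>Q. \<forall>w. ?Eo w = poly Q w"
  proof (rule entire_dominated_imp_poly[OF B AB0 E_hol[OF od] E_growth[OF od], where D = "D / q" and V = "\<lambda>x. W x / q"])
    show "AE x in \<mu>. 1 \<le> u x \<longrightarrow> norm (?Eo (of_real (u x))) \<le> D / q + W x / q"
      using odd
    proof eventually_elim
      case (elim x)
      show ?case
      proof
        assume "1 \<le> u x"
        then have "1 powr (real n / 2) \<le> u x powr (real n / 2)" by (intro powr_mono2) auto
        then have "1 \<le> \<bar>x\<bar>" unfolding abs_eq_u_powr[symmetric] by simp
        then have "1 * norm (?Eo (of_real (u x))) \<le> \<bar>x\<bar> * norm (?Eo (of_real (u x)))"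
          by (intro mult_right_mono) auto
        then show "norm (?Eo (of_real (u x))) \<le> D / q + W x / q" using elim by simp
      qed
    qed
  qed (use D W q in auto)
  then obtain Q where Q: "\<And>w. ?Eo w = poly Q w" by blast
  have "AE x in \<mu>. \<bar>x\<bar> * norm (poly Q (complex_of_real (u x))) \<le> D / q + W x / q"
    using odd by eventually_elim (simp add: Q)
  then have Q0: "Q = 0" using odd_poly_dominated_imp_zero[of "\<lambda>x. W x / q"] W(1) by simp
  have sum_e: "(\<Sum>m. even_coeff f m * w ^ m) = a * exp (- (of_real B * w))" for w
    using P[of w] by (simp add: E_def a exp_minus field_simps)
  have sum_o: "(\<Sum>m. odd_coeff f m * w ^ m) = 0" for w
    using Q[of w] by (simp add: E_def Q0)
  have odd0: "odd_coeff f m = 0" for m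
  proof (rule powser_zero_imp_coeff_zero)
    show "(\<lambda>m. odd_coeff f m * w ^ m) sums 0" for w
      using summable_sums[OF exp_type_powser(1)[OF A B od, of w]] by (simp add: sum_o)
  qed
  have even: "even_coeff f m = a * ((- of_real B) ^ m / fact m)" for m
  proof -
    have "even_coeff f m - a * ((- of_real B) ^ m / fact m) = 0"
    proof (rule powser_zero_imp_coeff_zero)
      fix w :: complex
      have "(\<lambda>m. a * ((- of_real B * w) ^ m / fact m)) sums (a * exp (- of_real B * w))"
        by (intro sums_mult exp_sums)
      moreover have "(\<lambda>m. even_coeff f m * w ^ m) sums (a * exp (- (of_real B * w)))"
        using summable_sums[OF exp_type_powser(1)[OF A B ev, of w]] by (simp add: sum_e)
      ultimately have "(\<lambda>m. even_coeff f m * w ^ m - a * ((- of_real B * w) ^ m / fact m)) sums 0"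
        using sums_diff by fastforce
      then show "(\<lambda>m. (even_coeff f m - a * ((- of_real B) ^ m / fact m)) * w ^ m) sums 0"
        unfolding power_mult_distrib by (simp add: algebra_simps)
    qed
    then show ?thesis by simp
  qed
  \<comment> \<open>Chosen so that \<open>f\<close> and \<open>s * gauss c\<close> have the same
    coefficients.\<close>
  define s where "s = a / of_real (gauss_const c)"
  have gc: "gauss_const c \<noteq> 0" using gauss_const_pos[OF c] by simp
  show ?thesis
  proof (rule that[of s])
    have "AE x in \<mu>. f x - s * gauss c x = 0"
    proof (rule zero_coeffs_imp_AE_zero[OF _ c])
      show "dominated (\<lambda>x. of_real (exp (c * u x)) * (f x - s * gauss c x))"
        using dominated_diff[OF dom dominated_gauss[of c], of s] by (simp add: algebra_simps)
      show "even_coeff (\<lambda>x. f x - s * gauss c x) m = 0" for m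
        unfolding coeff_diff(1)[OF assms(1) measurable_gauss c dom dominated_gauss] even even_coeff_gauss[OF c] B_def[symmetric]
        using gc by (simp add: s_def)
      show "odd_coeff (\<lambda>x. f x - s * gauss c x) m = 0" for m
        unfolding coeff_diff(2)[OF assms(1) measurable_gauss c dom dominated_gauss] odd0 odd_coeff_gauss by simp
    qed measurable
    then show "AE x in \<mu>. f x = s * gauss c x" by eventually_elim simp
    show "F_kn k n f l = s * of_real (gauss_const c) * gauss ((real n)\<^sup>2 / (4 * c)) l" for l
      unfolding F sum_e sum_o B_def[symmetric] using gc by (simp add: s_def gauss_def exp_of_real flip: of_real_mult of_real_minus)
  qed
qed

section \<open>The integrability conditions for Gaussians, and the two cases of the theorem\<close>

lemma Lp_finite_lower_bound:
  assumes p: "1 \<le> p" "p < \<infinity>" and L: "Lp_finite \<mu> p h" and ge: "AE x in \<mu>. norm (h x) \<ge> s" and s: "s \<ge> 0"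
  shows "s = 0"
proof (rule ccontr)
  assume "s \<noteq> 0"
  then have s0: "s > 0" using s by simp
  define r where "r = real_of_ereal p"
  have r: "r \<ge> 1" using p by (cases p) (auto simp: r_def)
  have "(\<integral>\<^sup>+ x. ennreal (s powr r) \<partial>\<mu>) \<le> (\<integral>\<^sup>+ x. ennreal (norm (h x) powr r) \<partial>\<mu>)"
    using ge by (intro nn_integral_mono_AE) (use s r in \<open>auto elim!: eventually_mono intro!: ennreal_leI powr_mono2\<close>)
  also have "\<dots> < \<infinity>" using L p by (simp add: Lp_finite_def r_def)
  finally have "ennreal (s powr r) * emeasure \<mu> UNIV < \<infinity>" by simp
  moreover have "{x. u x > -1} = UNIV" using u_nonneg by (auto intro: less_le_trans[of _ 0])
  ultimately show False using emeasure_mu_tail[of "-1"] s0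
    by (simp add: ennreal_mult_top)
qed

lemma Lp_finite_exp_decay:
  assumes p: "1 \<le> p" and d: "d > 0" and C: "C \<ge> 0" and eq: "\<And>x. norm (h x) = C * exp (- d * u x)"
  shows "Lp_finite \<mu> p h"
proof (cases "p = \<infinity>")
  case True
  have "norm (h x) \<le> C" for x unfolding eq using C d by (simp add: mult_left_le)
  then show ?thesis using True by (auto simp: Lp_finite_def)
next
  case False
  define r where "r = real_of_ereal p"
  have r: "r \<ge> 1" using p False by (cases p) (auto simp: r_def)
  have rd: "r * d > 0" using r d by simp
  have "(\<integral>\<^sup>+ x. ennreal (norm (h x) powr r) \<partial>\<mu>) = (\<integral>\<^sup>+ x. ennreal (C powr r) * ennreal (exp (- (r * d) * u x) * u x ^ 0) \<partial>\<mu>)"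
  proof (intro nn_integral_cong)
    fix x
    have "(C * exp (- d * u x)) powr r = C powr r * exp (- (r * d) * u x)"
      using C by (simp add: powr_mult exp_powr_real mult_ac)
    then show "ennreal (norm (h x) powr r) = ennreal (C powr r) * ennreal (exp (- (r * d) * u x) * u x ^ 0)"
      unfolding eq by (simp add: ennreal_mult'')
  qed
  also have "\<dots> = ennreal (C powr r) * (\<integral>\<^sup>+ x. ennreal (exp (- (r * d) * u x) * u x ^ 0) \<partial>\<mu>)"
    by (rule nn_integral_cmult) measurable
  also have "\<dots> < \<infinity>" unfolding nn_integral_mu_exp_moment[OF rd] by (simp add: ennreal_mult_less_top)
  finally show ?thesis using False by (simp add: Lp_finite_def r_def)
qed

text \<open>Tails have positive measure, so a relation valid almost everywhere holds at points with
  arbitrarily large \<open>u x\<close>, which is all that the independence of exponentials asks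
  for.\<close>

lemma gauss_independent:
  fixes \<sigma> :: "nat \<Rightarrow> real"
  assumes dec: "\<And>i j. i < j \<Longrightarrow> \<sigma> j < \<sigma> i"
    and zero: "AE x in \<mu>. (\<Sum>i<m. c i * gauss (\<sigma> i) x) = 0" and i: "i < m"
  shows "c i = 0"
proof (rule exp_sum_independent[where \<sigma> = \<sigma> and m = m and c = c])
  show "frequently (\<lambda>y. (\<Sum>i<m. c i * of_real (exp (- \<sigma> i * y))) = 0) at_top"
    unfolding frequently_def
  proof
    assume "eventually (\<lambda>y. (\<Sum>i<m. c i * of_real (exp (- \<sigma> i * y))) \<noteq> 0) at_top"
    then obtain r where r: "\<And>y. y \<ge> r \<Longrightarrow> (\<Sum>i<m. c i * of_real (exp (- \<sigma> i * y))) \<noteq> 0"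
      by (auto simp: eventually_at_top_linorder)
    have "AE x in \<mu>. u x > r \<longrightarrow> 1 \<le> (0::real)"
      using zero
    proof eventually_elim
      case (elim x)
      then show ?case using r[of "u x"] by (auto simp: gauss_def)
    qed
    then show False using integrable_imp_not_ge_1_tail[of "\<lambda>_. 0"] by simp
  qed
qed (use dec i in auto)

lemma cowling_price_zero:
  fixes f :: "real \<Rightarrow> complex"
  assumes a: "a > 0" and b: "b > 0" and ab: "a * b \<ge> 1/4"
    and p: "1 \<le> p" and q: "1 \<le> q" and pq: "min p q < \<infinity>"
    and [measurable]: "f \<in> borel_measurable borel"
    and Lp: "Lp_finite \<mu> p (\<lambda>x. of_real (exp (real n * a * u x)) * f x)"
    and Lq: "Lp_finite \<mu> q (\<lambda>l. of_real (exp (real n * b * u l)) * F_kn k n f l)"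
  shows "AE x in \<mu>. f x = 0"
proof -
  define c where "c = real n * a"
  have c: "c > 0" using n a by (simp add: c_def)
  have B_eq: "(real n)\<^sup>2 / (4 * c) = real n / (4 * a)" using n by (simp add: c_def power2_eq_square)
  \<comment> \<open>By \<open>a * b \<ge> 1/4\<close>, the weight of rate \<open>n * b\<close> may
    be weakened to the borderline rate.\<close>
  have B_le: "(real n)\<^sup>2 / (4 * c) \<le> real n * b"
  proof -
    have "1 / (4 * a) \<le> b" using ab a by (simp add: field_simps)
    then have "real n * (1 / (4 * a)) \<le> real n * b" by (intro mult_left_mono) auto
    then show ?thesis unfolding B_eq by simp
  qed
  have dom: "dominated (\<lambda>x. of_real (exp (c * u x)) * f x)"
    unfolding c_def by (rule Lp_finite_imp_dominated[OF _ p Lp]) measurable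
  have F: "F_kn k n f l = (\<Sum>m. even_coeff f m * of_real (u l) ^ m)
          + odd_factor * of_real l * (\<Sum>m. odd_coeff f m * of_real (u l) ^ m)" for l
    using F_kn_expansion[OF assms(7) c dom] by blast
  \<comment> \<open>Measurability of the transform is read off from its series expansion.\<close>
  have [measurable]: "F_kn k n f \<in> borel_measurable borel"
  proof -
    have "(\<lambda>l. \<Sum>m. cf m * complex_of_real (u l) ^ m) \<in> borel_measurable borel" for cf
      by measurable
    then show ?thesis unfolding F[abs_def] by measurable
  qed
  have "dominated (\<lambda>l. of_real (exp (real n * b * u l)) * F_kn k n f l)"
    by (rule Lp_finite_imp_dominated[OF _ q Lq]) measurable
  then have domF: "dominated (\<lambda>l. of_real (exp ((real n)\<^sup>2 / (4 * c) * u l)) * F_kn k n f l)"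
  proof (rule dominated_mono)
    show "norm (of_real (exp ((real n)\<^sup>2 / (4 * c) * u l)) * F_kn k n f l)
        \<le> norm (of_real (exp (real n * b * u l)) * F_kn k n f l)" for l
      unfolding norm_mult norm_of_real abs_exp_cancel
      using mult_right_mono[OF B_le, of "u l"] by (intro mult_right_mono) auto
  qed
  obtain s where s: "AE x in \<mu>. f x = s * gauss c x"
    "\<And>l. F_kn k n f l = s * of_real (gauss_const c) * gauss ((real n)\<^sup>2 / (4 * c)) l"
    using hardy_gauss[OF assms(7) c dom domF] by metis
  have "s = 0"
  \<comment> \<open>For finite \<open>p\<close>, the weighted \<open>f\<close> has norm
    \<open>norm s\<close> almost everywhere. Otherwise \<open>q\<close> is finite, and the weighted
    transform is at least \<open>norm s * gauss_const c\<close> in norm. The infinite mass of \<mu>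
    forces \<open>s = 0\<close> in both cases.\<close>
  proof (cases "p < \<infinity>")
    case True
    have "AE x in \<mu>. norm (of_real (exp (real n * a * u x)) * f x) \<ge> norm s"
      using s(1)
    proof eventually_elim
      case (elim x)
      have "norm (of_real (exp (real n * a * u x)) * f x) = norm s * exp (real n * a * u x + - c * u x)"
        unfolding elim gauss_def norm_mult norm_of_real exp_add by simp
      then show ?case by (simp add: c_def)
    qed
    then show ?thesis using Lp_finite_lower_bound[OF p True Lp] by force
  next
    case False
    then have q': "q < \<infinity>" using pq by (auto simp: min_def split: if_splits)
    have "norm (s * of_real (gauss_const c)) \<le> norm (of_real (exp (real n * b * u l)) * F_kn k n f l)" for l
    proof -
      have "0 \<le> (real n * b - (real n)\<^sup>2 / (4 * c)) * u l" using B_le by simp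
      then have "1 \<le> exp ((real n * b - (real n)\<^sup>2 / (4 * c)) * u l)" by simp
      also have "\<dots> = exp (real n * b * u l) * exp (- ((real n)\<^sup>2 / (4 * c)) * u l)"
        unfolding exp_add[symmetric] by (simp only: left_diff_distrib mult_minus_left) simp
      finally have "norm (s * of_real (gauss_const c)) * 1 \<le> norm (s * of_real (gauss_const c)) *
          (exp (real n * b * u l) * exp (- ((real n)\<^sup>2 / (4 * c)) * u l))"
        by (intro mult_left_mono) auto
      then show ?thesis unfolding s(2) gauss_def by (simp add: norm_mult mult_ac)
    qed
    then have "norm (s * of_real (gauss_const c)) = 0"
      using Lp_finite_lower_bound[OF q q' Lq, of "norm (s * of_real (gauss_const c))"] by auto
    then show ?thesis using gauss_const_pos[OF c] by simp
  qed
  then show ?thesis using s(1) by simp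
qed

lemma cowling_price_counterexamples:
  assumes a: "a > 0" and b: "b > 0" and ab: "a * b < 1/4" and p: "1 \<le> p" and q: "1 \<le> q"
  obtains g :: "nat \<Rightarrow> real \<Rightarrow> complex" where "\<And>i. g i \<in> borel_measurable borel"
    and "\<And>i. Lp_finite \<mu> p (\<lambda>x. of_real (exp (real n * a * u x)) * g i x)"
    and "\<And>i. Lp_finite \<mu> q (\<lambda>l. of_real (exp (real n * b * u l)) * F_kn k n (g i) l)"
    and "\<And>m c i. AE x in \<mu>. (\<Sum>i<m. c i * g i x) = 0 \<Longrightarrow> i < m \<Longrightarrow> c i = 0"
proof -
  \<comment> \<open>The length of the interval from \<open>a\<close> to \<open>1 / (4 * b)\<close>,
    positive exactly when \<open>a * b < 1/4\<close>.\<close>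
  define e where "e = 1 / (4 * b) - a"
  have e: "e > 0" using ab a b by (simp add: e_def field_simps)
  \<comment> \<open>Decreasing rates, above \<open>a\<close> for the decay of the function and below
    \<open>1 / (4 * b)\<close> for that of the transform; the shift by 2 keeps
    \<open>\<tau> 0\<close> strictly below the upper end.\<close>
  define \<tau> where "\<tau> = (\<lambda>i::nat. a + e / (real i + 2))"
  have \<tau>: "a < \<tau> i" "\<tau> i < 1 / (4 * b)" for i
  proof -
    show "a < \<tau> i" using e by (simp add: \<tau>_def)
    have "e / (real i + 2) < e / 1" using e by (intro divide_strict_left_mono) auto
    then show "\<tau> i < 1 / (4 * b)" by (simp add: \<tau>_def e_def)
  qed
  define \<sigma> where "\<sigma> = (\<lambda>i. real n * \<tau> i)"
  have n0: "real n > 0" using n by simp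
  have \<sigma>0: "\<sigma> i > 0" for i using \<tau>(1)[of i] a n0 by (simp add: \<sigma>_def)
  have dec: "\<sigma> j < \<sigma> i" if "i < j" for i j
    using that e n0 by (simp add: \<sigma>_def \<tau>_def divide_strict_left_mono)
  show ?thesis
  proof (rule that[of "\<lambda>i. gauss (\<sigma> i)"])
    fix i
    show "Lp_finite \<mu> p (\<lambda>x. of_real (exp (real n * a * u x)) * gauss (\<sigma> i) x)"
    proof (rule Lp_finite_exp_decay[OF p, where d = "real n * (\<tau> i - a)" and C = 1])
      show "real n * (\<tau> i - a) > 0" using \<tau>(1)[of i] n0 by simp
      show "norm (of_real (exp (real n * a * u x)) * gauss (\<sigma> i) x) = 1 * exp (- (real n * (\<tau> i - a)) * u x)" for x
        by (simp add: gauss_def norm_mult \<sigma>_def algebra_simps flip: exp_add)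
    qed simp
    show "Lp_finite \<mu> q (\<lambda>l. of_real (exp (real n * b * u l)) * F_kn k n (gauss (\<sigma> i)) l)"
    proof (rule Lp_finite_exp_decay[OF q, where d = "(real n)\<^sup>2 / (4 * \<sigma> i) - real n * b" and C = "gauss_const (\<sigma> i)"])
      have t0: "\<tau> i > 0" using \<tau>(1)[of i] a by simp
      have "b < 1 / (4 * \<tau> i)" using \<tau>(2)[of i] b t0 by (simp add: field_simps)
      then have "real n * b < real n * (1 / (4 * \<tau> i))" using n0 by (intro mult_strict_left_mono) auto
      also have "\<dots> = (real n)\<^sup>2 / (4 * \<sigma> i)" using n0 by (simp add: \<sigma>_def power2_eq_square)
      finally show "(real n)\<^sup>2 / (4 * \<sigma> i) - real n * b > 0" by simp
      show "gauss_const (\<sigma> i) \<ge> 0" using gauss_const_pos[OF \<sigma>0[of i]] by simp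
      show "norm (of_real (exp (real n * b * u l)) * F_kn k n (gauss (\<sigma> i)) l)
          = gauss_const (\<sigma> i) * exp (- ((real n)\<^sup>2 / (4 * \<sigma> i) - real n * b) * u l)" for l
      proof -
        have "- ((real n)\<^sup>2 / (4 * \<sigma> i) - real n * b) * u l = real n * b * u l + - ((real n)\<^sup>2 / (4 * \<sigma> i)) * u l"
          by (simp add: algebra_simps)
        then show ?thesis unfolding F_kn_gauss[OF \<sigma>0] exp_add norm_mult norm_of_real
          using gauss_const_pos[OF \<sigma>0[of i]] by (simp only: exp_add) simp
      qed
    qed
  qed (use gauss_independent[where \<sigma> = \<sigma>] dec in \<open>auto intro: measurable_gauss\<close>)
qed

end

theorem theorem5p4:
  fixes n :: nat and k a b :: real and p q :: ereal
  assumes "n \<ge> 1" and "k \<ge> (real n - 1) / (2 * real n)"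
    and "a > 0" and "b > 0"
    and "1 \<le> p" and "1 \<le> q" and "min p q < \<infinity>"
  shows "(a * b \<ge> 1/4 \<longrightarrow>
            (\<forall>f :: real \<Rightarrow> complex. f \<in> borel_measurable (mu_kn k n)
               \<and> Lp_finite (mu_kn k n) p (\<lambda>x. exp (real n * a * \<bar>x\<bar> powr (2 / real n)) * f x)
               \<and> Lp_finite (mu_kn k n) q (\<lambda>l. exp (real n * b * \<bar>l\<bar> powr (2 / real n)) * F_kn k n f l)
               \<longrightarrow> (AE x in mu_kn k n. f x = 0)))
       \<and> (a * b < 1/4 \<longrightarrow>
            (\<exists>g :: nat \<Rightarrow> real \<Rightarrow> complex.
               (\<forall>i. g i \<in> borel_measurable (mu_kn k n)
                  \<and> Lp_finite (mu_kn k n) p (\<lambda>x. exp (real n * a * \<bar>x\<bar> powr (2 / real n)) * g i x)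
                  \<and> Lp_finite (mu_kn k n) q (\<lambda>l. exp (real n * b * \<bar>l\<bar> powr (2 / real n)) * F_kn k n (g i) l))
               \<and> (\<forall>m (c :: nat \<Rightarrow> complex).
                    (AE x in mu_kn k n. (\<Sum>i<m. c i * g i x) = 0) \<longrightarrow> (\<forall>i<m. c i = 0))))"
proof -
  interpret kn_weight n k by unfold_locales (use assms in auto)
  have meas: "f \<in> borel_measurable (mu_kn k n) \<longleftrightarrow> f \<in> borel_measurable borel" for f :: "real \<Rightarrow> complex"
    by (simp cong: measurable_cong_sets)
  show ?thesis
  proof (intro conjI impI allI)
    fix f :: "real \<Rightarrow> complex"
    assume "a * b \<ge> 1/4" and f: "f \<in> borel_measurable (mu_kn k n)
               \<and> Lp_finite (mu_kn k n) p (\<lambda>x. exp (real n * a * \<bar>x\<bar> powr (2 / real n)) * f x)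
               \<and> Lp_finite (mu_kn k n) q (\<lambda>l. exp (real n * b * \<bar>l\<bar> powr (2 / real n)) * F_kn k n f l)"
    then show "AE x in mu_kn k n. f x = 0"
      using cowling_price_zero[OF assms(3,4) _ assms(5-7), of f] unfolding meas u_def by blast
  next
    assume ab: "a * b < 1/4"
    show "\<exists>g :: nat \<Rightarrow> real \<Rightarrow> complex.
               (\<forall>i. g i \<in> borel_measurable (mu_kn k n)
                  \<and> Lp_finite (mu_kn k n) p (\<lambda>x. exp (real n * a * \<bar>x\<bar> powr (2 / real n)) * g i x)
                  \<and> Lp_finite (mu_kn k n) q (\<lambda>l. exp (real n * b * \<bar>l\<bar> powr (2 / real n)) * F_kn k n (g i) l))
               \<and> (\<forall>m (c :: nat \<Rightarrow> complex).
                    (AE x in mu_kn k n. (\<Sum>i<m. c i * g i x) = 0) \<longrightarrow> (\<forall>i<m. c i = 0))"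
      by (rule cowling_price_counterexamples[OF assms(3,4) ab assms(5,6)])
         (unfold meas u_def, blast)
  qed
qed

end
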